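(* The topological space $\overline{A_0}$ is compact (Hausdorff).
   Context: $A_0$ is an apartment of an affine building, i.e. a Euclidean affine space with an affine Coxeter group $W=W(A_0)$; $\vec A_0$ is its direction space and $W^v=W(\vec A_0)$ is the finite group of linear parts of elements of $W$. A set $\mathcal F$ of nonempty subsets of $\vec A_0$ is fixed such that: (i) $\vec A_0$ is the disjoint union of the elements of $\mathcal F$; (ii) $\mathcal F$ is finite; (iii) $\{0\}\in\mathcal F$; (iv) each $\vec f\in\mathcal F$ is of the form $\{x:\alpha_1(x)=\dots=\alpha_r(x)=0,\ \alpha_{r+1}(x)>0,\dots,\alpha_n(x)>0\}$ for some linear forms $\alpha_1,\dots,\alpha_n\in\vec A_0^*$ (so it is a convex cone, open in its linear span); (v) the boundary $\overline{\vec f}\setminus\vec f$ of each $\vec f\in\mathcal F$ is a union of other elements of $\mathcal F$, called the faces of $\vec f$; (vi) if $\vec f$ is a face of $\vec g$ ($\vec f,\vec g\in\mathcal F$), then $\overline{\vec f}=\mathrm{Vect}(\vec f)\cap\overline{\vec g}$. An affine $\mathcal F$-cone is a subset $f=s+\vec f$ of $A_0$ with $s\in A_0$, $\vec f\in\mathcal F$; $\mathcal F_{A_0}$ is the set of these. Two affine $\mathcal F$-cones are equivalent, $f\sim g$, if they have the same direction and $f\cap g\neq\emptyset$; this is an equivalence relation, and $\overline{A_0}=\mathcal F_{A_0}/\!\sim$. Let $\mathcal U$ be the set of $W^v$-stable neighbourhoods of $0$ in $\vec A_0$. For $g\in\mathcal F_{A_0}$ and $U\in\mathcal U$ put $\mathcal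 V_{A_0}(g,U)=\{x\in\overline{A_0}: \exists h\in x,\ h\subset g+U\}$. $\overline{A_0}$ carries the unique topology for which, for every $x\in\overline{A_0}$, the sets $\mathcal V_{A_0}(g,U)$ with $g\in x$, $U\in\mathcal U$ form a base of neighbourhoods of $x$. *)

theory Defs
  imports "HOL-Analysis.Analysis" "HOL-Algebra.Bij" "HOL-Algebra.Generated_Groups"
begin

text \<open>
  A Euclidean affine space is represented as a nonempty affine subspace \<open>A\<close> of a Euclidean
  space. This distinguishes points of \<open>A\<close> from vectors of its direction space without choosing an
  origin, and it includes the zero-dimensional case, which \<open>A = UNIV\<close> alone would miss
  since every type of class \<open>euclidean_space\<close> has positive dimension.
\<close>

definition direction :: "'a::euclidean_space set \<Rightarrow> 'a set"
  where "direction A = {y - x |x y. x \<in> A \<and> y \<in> A}"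


section \<open>The Coxeter group of an apartment\<close>

text \<open>
  The orthogonal reflection of \<open>A\<close> along the hyperplane \<open>{x \<in> A. a \<bullet> x = c}\<close>. For a
  nonzero \<open>a\<close> in the direction of \<open>A\<close> every real \<open>c\<close> gives a hyperplane of \<open>A\<close>, and
  every hyperplane of \<open>A\<close> arises in this way. Maps of \<open>A\<close> are undefined outside \<open>A\<close>, as
  required by \<^const>\<open>BijGroup\<close>.
\<close>

definition affine_reflection :: "'a::euclidean_space set \<Rightarrow> 'a \<Rightarrow> real \<Rightarrow> 'a \<Rightarrow> 'a"
  where "affine_reflection A a c = (\<lambda>x\<in>A. x - (2 * (a \<bullet> x - c) / (a \<bullet> a)) *\<^sub>R a)"

definition affine_reflections :: "'a::euclidean_space set \<Rightarrow> ('a \<Rightarrow> 'a) set"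
  where "affine_reflections A =
    {affine_reflection A a c |a c. a \<in> direction A \<and> a \<noteq> 0}"

text \<open>A linear part is a map of the direction space, undefined outside of it, so that every
  element of \<open>W\<close> has exactly one linear part.\<close>

definition linear_parts :: "'a::euclidean_space set \<Rightarrow> ('a \<Rightarrow> 'a) set \<Rightarrow> ('a \<Rightarrow> 'a) set"
  where "linear_parts A W =
    {\<phi> \<in> extensional (direction A). \<exists>w\<in>W. \<forall>x\<in>A. \<forall>y\<in>A. \<phi> (y - x) = w y - w x}"

text \<open>
  The set of reflecting hyperplanes is not required to be locally finite. For discrete groups
  finiteness of the group of linear parts is automatic; requiring it directly also admits the
  non-discrete groups that occur for non-discrete affine buildings.
\<close>

definition affine_coxeter_group :: "'a::euclidean_space set \<Rightarrow> ('a \<Rightarrow> 'a) set \<Rightarrow> bool"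
  where "affine_coxeter_group A W \<longleftrightarrow>
    (\<exists>R \<subseteq> affine_reflections A. W = generate (BijGroup A) R) \<and> finite (linear_parts A W)"

definition apartment :: "'a::euclidean_space set \<Rightarrow> ('a \<Rightarrow> 'a) set \<Rightarrow> bool"
  where "apartment A W \<longleftrightarrow> affine A \<and> A \<noteq> {} \<and> affine_coxeter_group A W"


section \<open>Decompositions of the direction space into cones\<close>

text \<open>
  The linear forms below are linear forms on the ambient space; their restrictions to a subspace
  \<open>V\<close> are exactly the linear forms on \<open>V\<close>. The subspace \<open>V\<close> is closed, so closures
  in \<open>V\<close> and in the ambient space agree.
\<close>

definition polyhedral_cone :: "'a::euclidean_space set \<Rightarrow> 'a set \<Rightarrow> bool"
  where "polyhedral_cone V f \<longleftrightarrow>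
    (\<exists>P Q :: ('a \<Rightarrow> real) set. finite P \<and> finite Q \<and> (\<forall>\<alpha>\<in>P \<union> Q. linear \<alpha>) \<and>
      f = {x \<in> V. (\<forall>\<alpha>\<in>P. \<alpha> x = 0) \<and> (\<forall>\<alpha>\<in>Q. \<alpha> x > 0)})"

definition cone_boundary :: "'a::euclidean_space set \<Rightarrow> 'a set"
  where "cone_boundary f = closure f - f"

text \<open>This is a relation between members of the decomposition \<open>F\<close>, different from the relation
  \<^const>\<open>face_of\<close> of convex geometry.\<close>

definition cone_face :: "'a::euclidean_space set set \<Rightarrow> 'a set \<Rightarrow> 'a set \<Rightarrow> bool"
  where "cone_face F f g \<longleftrightarrow> f \<in> F \<and> g \<in> F \<and> f \<noteq> g \<and> f \<subseteq> cone_boundary g"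

definition conical_decomposition :: "'a::euclidean_space set \<Rightarrow> 'a set set \<Rightarrow> bool"
  where "conical_decomposition V F \<longleftrightarrow>
    {} \<notin> F \<and>
    disjoint F \<and> \<Union>F = V \<and>
    finite F \<and>
    {0} \<in> F \<and>
    (\<forall>f\<in>F. polyhedral_cone V f) \<and>
    (\<forall>f\<in>F. \<exists>G \<subseteq> F - {f}. cone_boundary f = \<Union>G) \<and>
    (\<forall>f g. cone_face F f g \<longrightarrow> closure f = span f \<inter> closure g)"


section \<open>The compactification of an apartment\<close>

definition affine_cones :: "'a::euclidean_space set \<Rightarrow> 'a set set \<Rightarrow> 'a set set"
  where "affine_cones A F = {(+) s ` f |s f. s \<in> A \<and> f \<in> F}"

definition cone_equiv :: "'a::euclidean_space set \<Rightarrow> 'a set set \<Rightarrow> ('a set \<times> 'a set) set"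
  where "cone_equiv A F =
    {((+) s ` f, (+) t ` f) |s t f. s \<in> A \<and> t \<in> A \<and> f \<in> F \<and> (+) s ` f \<inter> (+) t ` f \<noteq> {}}"

definition cone_classes :: "'a::euclidean_space set \<Rightarrow> 'a set set \<Rightarrow> 'a set set set"
  where "cone_classes A F = affine_cones A F // cone_equiv A F"

definition stable_nbhds :: "'a::euclidean_space set \<Rightarrow> ('a \<Rightarrow> 'a) set \<Rightarrow> 'a set set"
  where "stable_nbhds A W =
    {U. U \<subseteq> direction A \<and>
        (\<exists>S. openin (top_of_set (direction A)) S \<and> 0 \<in> S \<and> S \<subseteq> U) \<and>
        (\<forall>\<phi>\<in>linear_parts A W. \<phi> ` U \<subseteq> U)}"

definition basic_nbhd :: "'a::euclidean_space set \<Rightarrow> 'a set set \<Rightarrow> 'a set \<Rightarrow> 'a set \<Rightarrow> 'a set set set"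
  where "basic_nbhd A F g U = {x \<in> cone_classes A F. \<exists>h\<in>x. h \<subseteq> g + U}"

text \<open>Neighbourhoods, here and below, need not be open.\<close>

definition nbhd_base_of_point :: "'b topology \<Rightarrow> 'b \<Rightarrow> 'b set set \<Rightarrow> bool"
  where "nbhd_base_of_point T x B \<longleftrightarrow>
    (\<forall>N\<in>B. N \<subseteq> topspace T \<and> (\<exists>S. openin T S \<and> x \<in> S \<and> S \<subseteq> N)) \<and>
    (\<forall>S. openin T S \<and> x \<in> S \<longrightarrow> (\<exists>N\<in>B. N \<subseteq> S))"

definition is_cone_topology ::
    "'a::euclidean_space set \<Rightarrow> ('a \<Rightarrow> 'a) set \<Rightarrow> 'a set set \<Rightarrow> 'a set set topology \<Rightarrow> bool"
  where "is_cone_topology A W F T \<longleftrightarrow>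
    topspace T = cone_classes A F \<and>
    (\<forall>x\<in>cone_classes A F.
      nbhd_base_of_point T x {basic_nbhd A F g U |g U. g \<in> x \<and> U \<in> stable_nbhds A W})"

definition compactified_apartment ::
    "'a::euclidean_space set \<Rightarrow> ('a \<Rightarrow> 'a) set \<Rightarrow> 'a set set \<Rightarrow> 'a set set topology"
  where "compactified_apartment A W F = (THE T. is_cone_topology A W F T)"

section \<open>Existence and uniqueness of the topology\<close>

text \<open>The description in \<^const>\<open>compactified_apartment\<close> is proper: there is exactly one such topology.\<close>

lemma polyhedral_cone_add:
  assumes "polyhedral_cone V f" "subspace V" "a \<in> f" "b \<in> f"
  shows "a + b \<in> f"
proof -
  obtain P Q where PQ: "\<forall>\<alpha>\<in>P \<union> Q. linear (\<alpha> :: _ \<Rightarrow> real)"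
    "f = {x \<in> V. (\<forall>\<alpha>\<in>P. \<alpha> x = 0) \<and> (\<forall>\<alpha>\<in>Q. \<alpha> x > 0)}"
    using assms(1) unfolding polyhedral_cone_def by blast
  have L: "\<alpha> (a + b) = \<alpha> a + \<alpha> b" if "\<alpha> \<in> P \<union> Q" for \<alpha>
    using PQ(1) that by (auto intro: linear_add)
  have "\<alpha> (a + b) = 0" if "\<alpha> \<in> P" for \<alpha>
  proof -
    have "\<alpha> a = 0" "\<alpha> b = 0" using PQ(2) assms(3,4) that by blast+
    then show ?thesis using L[of \<alpha>] that by simp
  qed
  moreover have "\<alpha> (a + b) > 0" if "\<alpha> \<in> Q" for \<alpha>
  proof -
    have "\<alpha> a > 0" "\<alpha> b > 0" using PQ(2) assms(3,4) that by blast+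
    then show ?thesis using L[of \<alpha>] that by simp
  qed
  ultimately show ?thesis
    using PQ(2) assms(2-4) subspace_add by blast
qed

lemma affine_minus:
  assumes "affine A" "x \<in> A" "y \<in> A" "z \<in> A"
  shows "z + (y - x) \<in> A"
  using mem_affine_3_minus[OF assms(1) assms(4,3,2), of 1] by simp

lemma affine_direction:
  assumes "affine A" "A \<noteq> {}"
  shows "subspace (direction A)"
  unfolding direction_def
proof -
  obtain a where a: "a \<in> A" using assms(2) by blast
  have "{y - x |x y. x \<in> A \<and> y \<in> A} = {x - a |x. x \<in> A}"
    using a affine_minus[OF assms(1) _ _ a] by (auto, metis add_diff_cancel_left')
  moreover have "subspace {x - a |x. x \<in> A}"
    using affine_diffs_subspace_subtract[OF assms(1) a] by (simp add: Setcompr_eq_image)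
  ultimately show "subspace {y - x |x y. x \<in> A \<and> y \<in> A}" by simp
qed

lemma affine_add_direction:
  assumes "affine A" "z \<in> A" "v \<in> direction A"
  shows "z + v \<in> A"
  using assms affine_minus unfolding direction_def by blast

lemma affine_reflection_Bij:
  assumes "affine A" "r \<in> affine_reflections A"
  shows "r \<in> Bij A" and "\<And>x y. x \<in> A \<Longrightarrow> y \<in> A \<Longrightarrow> dist (r x) (r y) = dist x y"
proof -
  obtain a c where r: "r = affine_reflection A a c" "a \<in> direction A" "a \<noteq> 0"
    using assms(2) unfolding affine_reflections_def by blast
  have ne: "a \<bullet> a \<noteq> 0" using r(3) by simp
  have into: "r x \<in> A" if "x \<in> A" for x
  proof -
    have "A \<noteq> {}" using that by blast
    then have "x + (- (2 * (a \<bullet> x - c) / (a \<bullet> a))) *\<^sub>R a \<in> A"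
      by (intro affine_add_direction that assms subspace_scale affine_direction r(2))
    then show ?thesis using that by (simp add: r(1) affine_reflection_def)
  qed
  have inv: "r (r x) = x" if "x \<in> A" for x
  proof -
    let ?k = "2 * (a \<bullet> x - c) / (a \<bullet> a)"
    have rx: "r x = x - ?k *\<^sub>R a" using that by (simp add: r(1) affine_reflection_def)
    have "a \<bullet> r x - c = - (a \<bullet> x - c)"
      unfolding rx using ne by (simp add: inner_diff_right)
    moreover have "r (r x) = r x - (2 * (a \<bullet> r x - c) / (a \<bullet> a)) *\<^sub>R a"
      using into[OF that] by (simp add: r(1) affine_reflection_def)
    ultimately have "r (r x) = r x + ?k *\<^sub>R a"
      by (simp only:) (simp add: scaleR_left.minus[symmetric] minus_divide_left del: scaleR_minus_left)
    then show ?thesis by (simp add: rx)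
  qed
  show "r \<in> Bij A"
    unfolding Bij_def
  proof (intro IntI CollectI bij_betw_byWitness[where f' = r])
    show "r \<in> extensional A" by (simp add: r(1) affine_reflection_def)
  qed (use inv into in auto)
  fix x y assume xy: "x \<in> A" "y \<in> A"
  let ?d = "x - y" and ?k = "2 * (a \<bullet> (x - y)) / (a \<bullet> a)"
  have "r x - r y = ?d - ?k *\<^sub>R a"
    using xy by (simp add: r(1) affine_reflection_def inner_diff_right algebra_simps diff_divide_distrib)
  moreover have "(?d - ?k *\<^sub>R a) \<bullet> (?d - ?k *\<^sub>R a) = ?d \<bullet> ?d"
  proof -
    have "(?d - ?k *\<^sub>R a) \<bullet> (?d - ?k *\<^sub>R a) = ?d \<bullet> ?d - 2 * ?k * (a \<bullet> ?d) + ?k * (?k * (a \<bullet> a))"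
      by (simp only: inner_diff_left inner_diff_right inner_scaleR_left inner_scaleR_right inner_commute)
    also have "?k * (a \<bullet> a) = 2 * (a \<bullet> ?d)" using ne by simp
    finally show ?thesis by simp
  qed
  ultimately show "dist (r x) (r y) = dist x y"
    by (simp add: dist_norm norm_eq_sqrt_inner)
qed

lemma coxeter_isometry:
  assumes "affine A" "R \<subseteq> affine_reflections A" "w \<in> generate (BijGroup A) R"
  shows "w \<in> Bij A \<and> (\<forall>x\<in>A. \<forall>y\<in>A. dist (w x) (w y) = dist x y)"
  using assms(3)
proof (induction rule: generate.induct)
  case one
  then show ?case using id_Bij[of A] by (simp add: BijGroup_def restrict_def)
next
  case (incl h)
  then show ?case using affine_reflection_Bij[OF assms(1)] assms(2) by blast
next
  case (inv h)
  then have h: "h \<in> Bij A" "\<And>x y. x \<in> A \<Longrightarrow> y \<in> A \<Longrightarrow> dist (h x) (h y) = dist x y"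
    using affine_reflection_Bij[OF assms(1)] assms(2) by blast+
  have b: "bij_betw h A A" using h(1) by (simp add: Bij_def)
  show ?case
    unfolding inv_BijGroup[OF h(1)]
  proof (intro conjI ballI restrict_inv_into_Bij h(1))
    fix x y assume xy: "x \<in> A" "y \<in> A"
    let ?i = "inv_into A h"
    have "?i x \<in> A" "?i y \<in> A" "h (?i x) = x" "h (?i y) = y"
      using b xy by (auto simp: bij_betw_def inv_into_into f_inv_into_f)
    then show "dist ((\<lambda>x\<in>A. ?i x) x) ((\<lambda>x\<in>A. ?i x) y) = dist x y"
      using h(2)[of "?i x" "?i y"] xy by simp
  qed
next
  case (eng h1 h2)
  then have "h2 x \<in> A" if "x \<in> A" for x
    using that Bij_imp_funcset by blast
  then show ?case using eng
    by (simp add: BijGroup_def compose_Bij) (simp add: compose_def)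
qed

lemma linear_part_norm:
  assumes "apartment A W" "\<phi> \<in> linear_parts A W" "v \<in> direction A"
  shows "\<phi> v \<in> direction A" "norm (\<phi> v) = norm v"
proof -
  obtain x y where xy: "x \<in> A" "y \<in> A" "v = y - x"
    using assms(3) unfolding direction_def by blast
  obtain w where w: "w \<in> W" "\<phi> v = w y - w x"
    using assms(2) xy unfolding linear_parts_def by blast
  obtain R where R: "affine A" "R \<subseteq> affine_reflections A" "W = generate (BijGroup A) R"
    using assms(1) unfolding apartment_def affine_coxeter_group_def by blast
  have "w \<in> Bij A" "dist (w y) (w x) = dist y x"
    using coxeter_isometry[OF R(1,2), of w] w(1) R(3) xy(1,2) by simp_all
  then show "\<phi> v \<in> direction A" "norm (\<phi> v) = norm v"
    using xy w(2) Bij_imp_funcset[of w A] by (auto simp: direction_def dist_norm)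
qed

lemma ball_stable_nbhd:
  assumes "apartment A W" "e > 0"
  shows "ball 0 e \<inter> direction A \<in> stable_nbhds A W"
proof -
  have 0: "0 \<in> direction A"
    using assms affine_direction subspace_0 unfolding apartment_def by blast
  have "openin (top_of_set (direction A)) (ball 0 e \<inter> direction A)"
    by (subst Int_commute) (simp add: openin_open_Int)
  moreover have "0 \<in> ball 0 e \<inter> direction A" using 0 assms(2) by simp
  moreover have "\<phi> ` (ball 0 e \<inter> direction A) \<subseteq> ball 0 e \<inter> direction A"
    if "\<phi> \<in> linear_parts A W" for \<phi>
    using linear_part_norm[OF assms(1) that] by auto
  ultimately show ?thesis
    unfolding stable_nbhds_def by blast
qed

lemma stable_nbhd_ball:
  assumes "U \<in> stable_nbhds A W"
  shows "\<exists>e>0. ball 0 e \<inter> direction A \<subseteq> U"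
proof -
  obtain S where S: "openin (top_of_set (direction A)) S" "0 \<in> S" "S \<subseteq> U"
    using assms unfolding stable_nbhds_def by blast
  obtain T where T: "open T" "S = direction A \<inter> T"
    using S(1) by (auto simp: openin_open)
  obtain e where "e > 0" "ball 0 e \<subseteq> T"
    using T S(2) openE by blast
  then show ?thesis using S T by blast
qed

lemma polyhedral_cone_scale:
  assumes "polyhedral_cone V f" "subspace V" "a \<in> f" "(k::real) > 0"
  shows "k *\<^sub>R a \<in> f"
proof -
  obtain P Q where PQ: "\<forall>\<alpha>\<in>P \<union> Q. linear (\<alpha> :: _ \<Rightarrow> real)"
    "f = {x \<in> V. (\<forall>\<alpha>\<in>P. \<alpha> x = 0) \<and> (\<forall>\<alpha>\<in>Q. \<alpha> x > 0)}"
    using assms(1) unfolding polyhedral_cone_def by blast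
  have L: "\<alpha> (k *\<^sub>R a) = k * \<alpha> a" if "\<alpha> \<in> P \<union> Q" for \<alpha>
    using PQ(1) that by (auto simp: linear_scale)
  have "\<alpha> (k *\<^sub>R a) = 0" if "\<alpha> \<in> P" for \<alpha>
  proof -
    have "\<alpha> a = 0" using PQ(2) assms(3,4) that by blast
    then show ?thesis using L[of \<alpha>] that by simp
  qed
  moreover have "\<alpha> (k *\<^sub>R a) > 0" if "\<alpha> \<in> Q" for \<alpha>
  proof -
    have "\<alpha> a > 0" using PQ(2) assms(3,4) that by blast
    then show ?thesis using L[of \<alpha>] that assms(4) by simp
  qed
  ultimately show ?thesis
    using PQ(2) assms(2-4) subspace_scale by blast
qed

lemma polyhedral_cone_translate_closure:
  assumes "polyhedral_cone V f" "polyhedral_cone V f'" "subspace V" "f' = (+) v ` f"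
  shows "f \<subseteq> closure f'"
proof
  fix x assume x: "x \<in> f"
  define y where "y n = inverse (real (Suc n)) *\<^sub>R v + x" for n
  have "y n \<in> f'" for n
  proof -
    have "v + real (Suc n) *\<^sub>R x \<in> f'"
      using polyhedral_cone_scale[OF assms(1,3) x] assms(4) by auto
    from polyhedral_cone_scale[OF assms(2,3) this, of "inverse (real (Suc n))"]
    show ?thesis by (simp add: y_def scaleR_right_distrib del: of_nat_Suc)
  qed
  moreover have "y \<longlonglongrightarrow> 0 *\<^sub>R v + x"
    unfolding y_def by (intro tendsto_intros LIMSEQ_inverse_real_of_nat)
  ultimately show "x \<in> closure f'"
    by (auto simp: closure_sequential)
qed

lemma closure_polyhedral_cone:
  assumes "\<forall>\<alpha>\<in>P \<union> Q. linear (\<alpha> :: 'a::euclidean_space \<Rightarrow> real)"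
    "f = {x \<in> V. (\<forall>\<alpha>\<in>P. \<alpha> x = 0) \<and> (\<forall>\<alpha>\<in>Q. \<alpha> x > 0)}" "subspace V" "x \<in> closure f"
  shows "x \<in> V" "\<forall>\<alpha>\<in>P. \<alpha> x = 0" "\<forall>\<alpha>\<in>Q. \<alpha> x \<ge> 0"
proof -
  have c: "continuous_on UNIV \<alpha>" if "\<alpha> \<in> P \<union> Q" for \<alpha>
    using assms(1) that by (auto intro: linear_continuous_on linear_conv_bounded_linear[THEN iffD1])
  have "closed (V \<inter> (\<Inter>\<alpha>\<in>P. {x. \<alpha> x = 0}) \<inter> (\<Inter>\<alpha>\<in>Q. {x. \<alpha> x \<ge> 0}))"
    using c by (intro closed_Int closed_INT ballI closed_subspace assms(3) closed_Collect_eq closed_Collect_le) auto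
  then have "closure f \<subseteq> V \<inter> (\<Inter>\<alpha>\<in>P. {x. \<alpha> x = 0}) \<inter> (\<Inter>\<alpha>\<in>Q. {x. \<alpha> x \<ge> 0})"
    by (rule closure_minimal[rotated]) (auto simp: assms(2) intro: less_imp_le)
  then show "x \<in> V" "\<forall>\<alpha>\<in>P. \<alpha> x = 0" "\<forall>\<alpha>\<in>Q. \<alpha> x \<ge> 0"
    using assms(4) by auto
qed

lemma polyhedral_cone_small:
  assumes "polyhedral_cone V f" "subspace V" "x \<in> f" "y \<in> closure f"
  shows "\<exists>e>0. x - e *\<^sub>R y \<in> f"
proof -
  obtain P Q where PQ: "\<forall>\<alpha>\<in>P \<union> Q. linear (\<alpha> :: _ \<Rightarrow> real)" "finite Q"
    "f = {x \<in> V. (\<forall>\<alpha>\<in>P. \<alpha> x = 0) \<and> (\<forall>\<alpha>\<in>Q. \<alpha> x > 0)}"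
    using assms(1) unfolding polyhedral_cone_def by blast
  note y = closure_polyhedral_cone[OF PQ(1,3) assms(2,4)]
  have L: "\<alpha> (x - e *\<^sub>R y) = \<alpha> x - e * \<alpha> y" if "\<alpha> \<in> P \<union> Q" for \<alpha> e
    using PQ(1) that by (auto simp: linear_scale linear_diff)
  have "\<forall>\<^sub>F e in at_right (0::real). \<alpha> x - e * \<alpha> y > 0" if "\<alpha> \<in> Q" for \<alpha>
  proof -
    have "((\<lambda>e. \<alpha> x - e * \<alpha> y) \<longlongrightarrow> \<alpha> x - 0 * \<alpha> y) (at_right 0)"
      by (intro tendsto_intros)
    then show ?thesis using that assms(3) PQ(3) order_tendstoD(1) by fastforce
  qed
  then have "\<forall>\<^sub>F e in at_right (0::real). e > 0 \<and> (\<forall>\<alpha>\<in>Q. \<alpha> x - e * \<alpha> y > 0)"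
    using PQ(2) by (auto intro!: eventually_conj eventually_at_right_less eventually_ball_finite)
  then obtain e :: real where e: "e > 0" "\<forall>\<alpha>\<in>Q. \<alpha> x - e * \<alpha> y > 0"
    using eventually_happens' trivial_limit_at_right_real by blast
  have "\<alpha> (x - e *\<^sub>R y) = 0" if "\<alpha> \<in> P" for \<alpha>
  proof -
    have "\<alpha> x = 0" "\<alpha> y = 0" using PQ(3) assms(3) y(2) that by blast+
    then show ?thesis using L[of \<alpha> e] that by simp
  qed
  moreover have "\<alpha> (x - e *\<^sub>R y) > 0" if "\<alpha> \<in> Q" for \<alpha>
    using L[of \<alpha> e] e that by simp
  moreover have "x - e *\<^sub>R y \<in> V"
    using assms(2,3) y PQ(3) by (auto intro: subspace_diff subspace_scale)
  ultimately have "x - e *\<^sub>R y \<in> f" using PQ(3) by blast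
  then show ?thesis using e(1) by blast
qed

lemma translate_cone_eq:
  assumes "conical_decomposition V F" "subspace V" "f \<in> F" "f' \<in> F" "(+) s ` f = (+) t ` f'"
  shows "f = f'"
proof (rule ccontr)
  assume ne: "f \<noteq> f'"
  have F: "f \<noteq> {}" "f' \<noteq> {}" "polyhedral_cone V f" "polyhedral_cone V f'" "f \<inter> f' = {}"
    using assms(1,3,4) ne unfolding conical_decomposition_def disjoint_def by auto
  have e1: "f = (+) (t - s) ` f'"
  proof -
    have "f = (+) (- s) ` (+) s ` f" by (simp only: image_image) simp
    also have "\<dots> = (+) (t - s) ` f'"
      unfolding assms(5) image_image by (rule image_cong) simp_all
    finally show ?thesis .
  qed
  have e2: "f' = (+) (s - t) ` f" by (subst e1, simp only: image_image) simp
  have c: "f' \<subseteq> closure f" "f \<subseteq> closure f'"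
    using polyhedral_cone_translate_closure assms(2) F e1 e2 by blast+
  obtain x y where xy: "x \<in> f'" "y \<in> f" using F by blast
  obtain e where e: "e > 0" "x - e *\<^sub>R y \<in> f'"
    using polyhedral_cone_small[OF F(4) assms(2) xy(1)] c xy(2) by blast
  obtain P Q where PQ: "\<forall>\<alpha>\<in>P \<union> Q. linear (\<alpha> :: _ \<Rightarrow> real)"
    "f = {x \<in> V. (\<forall>\<alpha>\<in>P. \<alpha> x = 0) \<and> (\<forall>\<alpha>\<in>Q. \<alpha> x > 0)}"
    using F(3) unfolding polyhedral_cone_def by blast
  have L: "\<alpha> (x - e *\<^sub>R y) = \<alpha> x - e * \<alpha> y" if "\<alpha> \<in> P \<union> Q" for \<alpha>
    using PQ(1) that by (auto simp: linear_scale linear_diff)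
  have x: "x \<in> closure f" "x - e *\<^sub>R y \<in> closure f" using c(1) xy(1) e(2) by blast+
  have "\<alpha> x > 0" if "\<alpha> \<in> Q" for \<alpha>
  proof -
    have "\<alpha> x - e * \<alpha> y \<ge> 0"
      using closure_polyhedral_cone(3)[OF PQ assms(2) x(2)] L that by fastforce
    moreover have "e * \<alpha> y > 0" using e(1) xy(2) PQ(2) that by simp
    ultimately show ?thesis by linarith
  qed
  then have "x \<in> f"
    using closure_polyhedral_cone(1,2)[OF PQ assms(2) x(1)] PQ(2) by blast
  then show False using xy(1) F(5) by blast
qed

lemma equiv_cone_equiv:
  assumes "affine A" "A \<noteq> {}" "conical_decomposition (direction A) F"
  shows "equiv (affine_cones A F) (cone_equiv A F)"
proof -
  have sub: "subspace (direction A)"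
    using assms affine_direction by blast
  have F: "f \<noteq> {}" "polyhedral_cone (direction A) f" if "f \<in> F" for f
    using assms(3) that unfolding conical_decomposition_def by auto
  have add: "a + b \<in> f" if "f \<in> F" "a \<in> f" "b \<in> f" for a b f
    using polyhedral_cone_add[OF F(2) sub] that by blast
  have tr: "(s, u) \<in> cone_equiv A F" if st: "(s, t) \<in> cone_equiv A F" and tu: "(t, u) \<in> cone_equiv A F" for s t u
  proof -
    obtain p q f where f: "s = (+) p ` f" "t = (+) q ` f" "p \<in> A" "q \<in> A" "f \<in> F"
      "(+) p ` f \<inter> (+) q ` f \<noteq> {}"
      using st unfolding cone_equiv_def by blast
    obtain q' r f' where f': "t = (+) q' ` f'" "u = (+) r ` f'" "q' \<in> A" "r \<in> A" "f' \<in> F"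
      "(+) q' ` f' \<inter> (+) r ` f' \<noteq> {}"
      using tu unfolding cone_equiv_def by blast
    have [simp]: "f' = f" using translate_cone_eq[OF assms(3) sub f(5) f'(5)] f(2) f'(1) by metis
    obtain a b where ab: "a \<in> f" "b \<in> f" "p + a = q + b" using f(6) by blast
    have "(+) q ` f \<inter> (+) r ` f \<noteq> {}" using f'(6) f(2) f'(1) by simp
    then obtain c d where cd: "c \<in> f" "d \<in> f" "q + c = r + d" by blast
    have "p + (a + c) = r + (d + b)" using ab(3) cd(3) by (metis add.assoc add.commute)
    then have "(+) p ` f \<inter> (+) r ` f \<noteq> {}"
      using add[OF f(5) ab(1) cd(1)] add[OF f(5) cd(2) ab(2)] by blast
    then have "((+) p ` f, (+) r ` f) \<in> cone_equiv A F"
      using f(3,5) f'(4) unfolding cone_equiv_def by blast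
    then show ?thesis using f(1) f'(2) by simp
  qed
  show ?thesis
  proof (rule equivI)
    show "cone_equiv A F \<subseteq> affine_cones A F \<times> affine_cones A F"
      unfolding cone_equiv_def affine_cones_def by blast
    show "refl_on (affine_cones A F) (cone_equiv A F)"
    proof (rule refl_onI)
      fix g assume "g \<in> affine_cones A F"
      then obtain s f where g: "g = (+) s ` f" "s \<in> A" "f \<in> F"
        unfolding affine_cones_def by blast
      have "(+) s ` f \<inter> (+) s ` f \<noteq> {}" using F(1)[OF g(3)] by simp
      then show "(g, g) \<in> cone_equiv A F" using g unfolding cone_equiv_def by blast
    qed
    show "sym (cone_equiv A F)"
    proof (rule symI)
      fix g h assume "(g, h) \<in> cone_equiv A F"
      then obtain p q f where f: "g = (+) p ` f" "h = (+) q ` f" "p \<in> A" "q \<in> A" "f \<in> F"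
        "(+) p ` f \<inter> (+) q ` f \<noteq> {}"
        unfolding cone_equiv_def by blast
      have "(+) q ` f \<inter> (+) p ` f \<noteq> {}" using f(6) by (subst Int_commute)
      then show "(h, g) \<in> cone_equiv A F" using f(1-5) unfolding cone_equiv_def by blast
    qed
    show "trans (cone_equiv A F)" using tr by (rule transI)
  qed
qed

lemma cone_class_directed:
  assumes "affine A" "A \<noteq> {}" "conical_decomposition (direction A) F"
    and "x \<in> cone_classes A F" "g \<in> x" "h \<in> x"
  shows "\<exists>k\<in>x. k \<subseteq> g \<and> k \<subseteq> h"
proof -
  have sub: "subspace (direction A)"
    using assms affine_direction by blast
  have F: "f \<noteq> {}" "polyhedral_cone (direction A) f" "f \<subseteq> direction A" if "f \<in> F" for f
    using assms(3) that unfolding conical_decomposition_def by auto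
  have add: "a + b \<in> f" if "f \<in> F" "a \<in> f" "b \<in> f" for a b f
    using polyhedral_cone_add[OF F(2) sub] that by blast
  note eq = equiv_cone_equiv[OF assms(1-3)]
  have "(g, h) \<in> cone_equiv A F"
    using quotient_eq_iff[OF eq] assms(4-6) unfolding cone_classes_def by blast
  then obtain p q f where f: "g = (+) p ` f" "h = (+) q ` f" "p \<in> A" "q \<in> A" "f \<in> F"
      "(+) p ` f \<inter> (+) q ` f \<noteq> {}"
    unfolding cone_equiv_def by blast
  then obtain a b where ab: "a \<in> f" "b \<in> f" "p + a = q + b" by blast
  define k where "k = (+) (p + a) ` f"
  have pa: "p + a \<in> A" using affine_add_direction assms(1) f(3) F(3)[OF f(5)] ab(1) by blast
  have "k \<subseteq> g" using add[OF f(5) ab(1)] unfolding k_def f(1) by (auto simp: add.assoc)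
  moreover have "k \<subseteq> h" using add[OF f(5) ab(2)] unfolding k_def f(2) ab(3) by (auto simp: add.assoc)
  moreover have "(g, k) \<in> cone_equiv A F"
  proof -
    have "g \<inter> k \<noteq> {}" using \<open>k \<subseteq> g\<close> F(1)[OF f(5)] unfolding k_def by auto
    then show ?thesis using f pa unfolding cone_equiv_def k_def by blast
  qed
  then have "k \<in> x"
    using assms(4,5) in_quotient_imp_closed[OF eq] unfolding cone_classes_def by blast
  ultimately show ?thesis by blast
qed

lemma nbhd_base_of_point_unique:
  assumes "\<forall>x\<in>X. nbhd_base_of_point S x (B x)" "\<forall>x\<in>X. nbhd_base_of_point T x (B x)"
    and "topspace S = X" "topspace T = X"
  shows "S = T"
proof -
  have "openin T' O'" if S': "\<forall>x\<in>X. nbhd_base_of_point S' x (B x)" and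
    T': "\<forall>x\<in>X. nbhd_base_of_point T' x (B x)" and "topspace S' = X" and O': "openin S' O'" for S' T' O'
  proof (subst openin_subopen, intro ballI)
    fix x assume x: "x \<in> O'"
    then have "x \<in> X" using O' that(3) openin_subset by blast
    then obtain N where "N \<in> B x" "N \<subseteq> O'"
      using S' O' x unfolding nbhd_base_of_point_def by blast
    then show "\<exists>Q. openin T' Q \<and> x \<in> Q \<and> Q \<subseteq> O'"
      using T' \<open>x \<in> X\<close> unfolding nbhd_base_of_point_def by (meson subset_trans)
  qed
  then show ?thesis unfolding topology_eq using assms by metis
qed

lemma ex1_cone_topology:
  assumes "apartment A W" "conical_decomposition (direction A) F"
  shows "\<exists>!T. is_cone_topology A W F T"
proof (rule ex_ex1I)
  fix S T assume "is_cone_topology A W F S" "is_cone_topology A W F T"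
  then show "S = T"
    unfolding is_cone_topology_def
    by (elim conjE) (rule nbhd_base_of_point_unique[where X = "cone_classes A F" and
          B = "\<lambda>x. {basic_nbhd A F g U |g U. g \<in> x \<and> U \<in> stable_nbhds A W}"])
next
  have A: "affine A" "A \<noteq> {}" using assms(1) unfolding apartment_def by auto
  have sub: "subspace (direction A)" using A affine_direction by blast
  note eq = equiv_cone_equiv[OF A assms(2)]
  note dir = cone_class_directed[OF A assms(2)]
  let ?X = "cone_classes A F" and ?U = "stable_nbhds A W"
  have mono: "basic_nbhd A F g U \<subseteq> basic_nbhd A F g' U'" if "g \<subseteq> g'" "U \<subseteq> U'" for g g' U U'
    using set_plus_mono2[OF that] unfolding basic_nbhd_def by blast
  have ne: "\<exists>g. g \<in> x" if "x \<in> ?X" for x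
    using in_quotient_imp_non_empty[OF eq, of x] that unfolding cone_classes_def by auto
  have Une: "\<exists>U. U \<in> ?U" using ball_stable_nbhd[OF assms(1) zero_less_one] by (rule exI)
  have Uint: "U \<inter> V \<in> ?U" if UV: "U \<in> ?U" "V \<in> ?U" for U V
  proof -
    obtain S where S: "openin (top_of_set (direction A)) S" "0 \<in> S" "S \<subseteq> U"
      using UV(1) unfolding stable_nbhds_def by blast
    obtain S' where S': "openin (top_of_set (direction A)) S'" "0 \<in> S'" "S' \<subseteq> V"
      using UV(2) unfolding stable_nbhds_def by blast
    have "\<exists>S. openin (top_of_set (direction A)) S \<and> 0 \<in> S \<and> S \<subseteq> U \<inter> V"
      using S S' openin_Int by (intro exI[of _ "S \<inter> S'"]) blast
    then show ?thesis using UV unfolding stable_nbhds_def by blast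
  qed
  have half: "\<exists>V\<in>?U. V + V \<subseteq> U" if U: "U \<in> ?U" for U
  proof -
    obtain e where e: "e > 0" "ball 0 e \<inter> direction A \<subseteq> U"
      using stable_nbhd_ball[OF U] by blast
    let ?V = "ball 0 (e/2) \<inter> direction A"
    have "v + w \<in> U" if "v \<in> ?V" "w \<in> ?V" for v w
    proof -
      have "norm (v + w) < e" using that norm_triangle_ineq[of v w] by simp
      then show ?thesis using e(2) that subspace_add[OF sub] by auto
    qed
    then have "?V + ?V \<subseteq> U" by (auto simp: set_plus_def)
    then show ?thesis using ball_stable_nbhd[OF assms(1), of "e/2"] e(1) by (meson half_gt_zero)
  qed
  have 0: "0 \<in> U" if "U \<in> ?U" for U using that unfolding stable_nbhds_def by blast
  define op where "op S \<longleftrightarrow> S \<subseteq> ?X \<and> (\<forall>x\<in>S. \<exists>g\<in>x. \<exists>U\<in>?U. basic_nbhd A F g U \<subseteq> S)" for S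
  have "istopology op"
    unfolding istopology_def
  proof (intro conjI allI impI)
    fix S T assume "op S" "op T"
    show "op (S \<inter> T)"
      unfolding op_def
    proof (intro conjI ballI)
      show "S \<inter> T \<subseteq> ?X" using \<open>op S\<close> unfolding op_def by blast
      fix x assume x: "x \<in> S \<inter> T"
      obtain g U where g: "g \<in> x" "U \<in> ?U" "basic_nbhd A F g U \<subseteq> S"
        using \<open>op S\<close> x unfolding op_def by blast
      obtain h V where h: "h \<in> x" "V \<in> ?U" "basic_nbhd A F h V \<subseteq> T"
        using \<open>op T\<close> x unfolding op_def by blast
      have "x \<in> ?X" using \<open>op S\<close> x unfolding op_def by blast
      then obtain k where "k \<in> x" "k \<subseteq> g" "k \<subseteq> h" using dir g(1) h(1) by blast
      moreover have "basic_nbhd A F k (U \<inter> V) \<subseteq> S \<inter> T"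
        using mono[OF \<open>k \<subseteq> g\<close>, of "U \<inter> V" U] mono[OF \<open>k \<subseteq> h\<close>, of "U \<inter> V" V] g(3) h(3) by blast
      ultimately show "\<exists>g\<in>x. \<exists>U\<in>?U. basic_nbhd A F g U \<subseteq> S \<inter> T"
        using Uint g(2) h(2) by blast
    qed
  next
    fix K assume "\<forall>S\<in>K. op S"
    then show "op (\<Union>K)"
      unfolding op_def by (meson Sup_least UnionE Union_upper subset_trans)
  qed
  then have oi: "openin (topology op) = op" by (rule topology_inverse')
  have "op ?X"
    unfolding op_def using ne Une by (auto simp: basic_nbhd_def)
  then have ts: "topspace (topology op) = ?X"
    unfolding topspace_def oi by (auto simp: op_def)
  have "nbhd_base_of_point (topology op) x {basic_nbhd A F g U |g U. g \<in> x \<and> U \<in> ?U}"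
    if x: "x \<in> ?X" for x
    unfolding nbhd_base_of_point_def oi ts
  proof (intro conjI ballI allI impI)
    fix N assume "N \<in> {basic_nbhd A F g U |g U. g \<in> x \<and> U \<in> ?U}"
    then obtain g U where N: "N = basic_nbhd A F g U" "g \<in> x" "U \<in> ?U" by blast
    show "N \<subseteq> ?X" unfolding N basic_nbhd_def by blast
    define S where "S = {y \<in> ?X. \<exists>h\<in>y. \<exists>V\<in>?U. basic_nbhd A F h V \<subseteq> N}"
    have sub_self: "y \<in> basic_nbhd A F h V" if "y \<in> ?X" "h \<in> y" "V \<in> ?U" for y h V
      using that 0 by (auto simp: basic_nbhd_def set_plus_def intro!: bexI[of _ h])
        (metis add.right_neutral)
    have "S \<subseteq> N" unfolding S_def using sub_self by blast
    moreover have "x \<in> S" unfolding S_def using x N by blast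
    moreover have "op S"
      unfolding op_def
    proof (intro conjI ballI)
      show "S \<subseteq> ?X" unfolding S_def by blast
      fix y assume "y \<in> S"
      then obtain h V where h: "h \<in> y" "V \<in> ?U" "basic_nbhd A F h V \<subseteq> N"
        unfolding S_def by blast
      obtain V' where V': "V' \<in> ?U" "V' + V' \<subseteq> V" using half[OF h(2)] by blast
      have "z \<in> S" if z: "z \<in> basic_nbhd A F h V'" for z
      proof -
        obtain k where k: "z \<in> ?X" "k \<in> z" "k \<subseteq> h + V'"
          using z unfolding basic_nbhd_def by blast
        have "basic_nbhd A F k V' \<subseteq> basic_nbhd A F h V"
        proof -
          have "k + V' \<subseteq> (h + V') + V'" using k(3) by (intro set_plus_mono2) auto
          also have "\<dots> = h + (V' + V')" by (simp add: add.assoc)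
          also have "\<dots> \<subseteq> h + V" using V'(2) by (intro set_plus_mono2) auto
          finally show ?thesis unfolding basic_nbhd_def by blast
        qed
        then show ?thesis unfolding S_def using k h(3) V'(1) by blast
      qed
      then show "\<exists>g\<in>y. \<exists>U\<in>?U. basic_nbhd A F g U \<subseteq> S" using h(1) V'(1) by blast
    qed
    ultimately show "\<exists>S. op S \<and> x \<in> S \<and> S \<subseteq> N" by blast
  next
    fix S assume "op S \<and> x \<in> S"
    then show "\<exists>N\<in>{basic_nbhd A F g U |g U. g \<in> x \<and> U \<in> ?U}. N \<subseteq> S"
      unfolding op_def by blast
  qed
  then have "is_cone_topology A W F (topology op)"
    unfolding is_cone_topology_def using ts by blast
  then show "\<exists>T. is_cone_topology A W F T" ..
qed

corollary is_cone_topology_compactified_apartment: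
  assumes "apartment A W" "conical_decomposition (direction A) F"
  shows "is_cone_topology A W F (compactified_apartment A W F)"
  unfolding compactified_apartment_def
  using ex1_cone_topology[OF assms] by (rule theI')

end

theory Submission
  imports Defs
begin

text \<open>
  A point of the compactification is the class of an affine cone \<open>s + f\<close>. Replacing \<open>s\<close> by
  \<open>s + u\<close> with \<open>u \<in> f\<close> does not change the class, so every class has representatives that lie
  arbitrarily deep in the direction of the cone. Both halves of the theorem rest on this.

  Hausdorff. Two different classes have representatives \<open>p\<close>, \<open>q\<close> on which some linear form takes
  values \<open>\<ge> c\<close> and \<open>\<le> d\<close>, with \<open>d < c\<close> (\<open>separate_classes\<close>). If the two directions \<open>f\<close> and \<open>g\<close>
  differ, they are disjoint convex cones, and a hyperplane through \<open>0\<close> separates them properly;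
  going deep into the cone on which the form is not zero creates the gap. If the directions agree,
  the two apices differ by a vector outside \<open>span f\<close>, and a form that vanishes on \<open>f\<close> tells them
  apart. Thickening \<open>p\<close> and \<open>q\<close> by a small ball keeps a gap. A class in both neighbourhoods would
  contain a cone near \<open>p\<close> and one near \<open>q\<close>, hence also a cone inside both of these, which the gap
  forbids.

  Compactness. The space is a finite union of continuous images of cubes \<open>[0, \<infinity>]\<^sup>S\<close>. Fix a point
  \<open>p\<close> of the apartment. The closure of each \<open>f \<in> F\<close> is generated as a convex cone by a finite set
  \<open>S\<close>, and a tuple \<open>c\<close> of coefficients in \<open>[0, \<infinity>]\<close> is sent to the class of
  \<open>p + (\<Sum>v. c v v) + k\<close>, where the sum is over the \<open>v\<close> with finite coefficient and \<open>k\<close> is the member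
  of \<open>F\<close> that contains the sum of the generators with infinite coefficient (\<open>limit_class\<close>).

  What makes this map continuous and the images cover the space is a facial property of \<open>F\<close>: if two
  points in the closure of a member have their sum in a member \<open>k\<close>, then both lie in the closure of
  \<open>k\<close> (\<open>summand_in_closure\<close>). So the generators with infinite coefficient lie in the closure of \<open>k\<close>,
  and making their coefficients large moves the cone deep into \<open>k\<close>. This property is where the
  condition \<open>closure f = span f \<inter> closure g\<close> on the faces of the decomposition enters.
\<close>

section \<open>Closures of polyhedral cones\<close>

lemma closure_polyhedral_cone_eq:
  assumes lin: "\<forall>\<alpha>\<in>P \<union> Q. linear (\<alpha> :: 'a::euclidean_space \<Rightarrow> real)"
    and f: "f = {x \<in> V. (\<forall>\<alpha>\<in>P. \<alpha> x = 0) \<and> (\<forall>\<alpha>\<in>Q. \<alpha> x > 0)}"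
    and V: "subspace V" and ne: "f \<noteq> {}"
  shows "closure f = {x \<in> V. (\<forall>\<alpha>\<in>P. \<alpha> x = 0) \<and> (\<forall>\<alpha>\<in>Q. \<alpha> x \<ge> 0)}"
proof (intro equalityI subsetI)
  fix x assume "x \<in> closure f"
  then show "x \<in> {x \<in> V. (\<forall>\<alpha>\<in>P. \<alpha> x = 0) \<and> (\<forall>\<alpha>\<in>Q. \<alpha> x \<ge> 0)}"
    using closure_polyhedral_cone[OF lin f V] by blast
next
  fix x assume x: "x \<in> {x \<in> V. (\<forall>\<alpha>\<in>P. \<alpha> x = 0) \<and> (\<forall>\<alpha>\<in>Q. \<alpha> x \<ge> 0)}"
  obtain w where w: "w \<in> f" using ne by blast
  have "x + r *\<^sub>R w \<in> f" if "r > 0" for r :: real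
  proof -
    have L: "\<alpha> (x + r *\<^sub>R w) = \<alpha> x + r * \<alpha> w" if "\<alpha> \<in> P \<union> Q" for \<alpha>
      using lin that by (auto simp: linear_add linear_scale)
    have "\<alpha> (x + r *\<^sub>R w) = 0" if "\<alpha> \<in> P" for \<alpha>
      using L[of \<alpha>] x w f that by auto
    moreover have "\<alpha> (x + r *\<^sub>R w) > 0" if "\<alpha> \<in> Q" for \<alpha>
    proof -
      have "\<alpha> x \<ge> 0" "\<alpha> w > 0" using x w f that by auto
      then show ?thesis using L[of \<alpha>] \<open>r > 0\<close> that by (simp add: add_nonneg_pos)
    qed
    moreover have "x + r *\<^sub>R w \<in> V"
      using x w f V by (auto intro: subspace_add subspace_scale)
    ultimately show ?thesis using f by blast
  qed
  then have "x + inverse (real (Suc n)) *\<^sub>R w \<in> f" for n by simp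
  moreover have "(\<lambda>n. x + inverse (real (Suc n)) *\<^sub>R w) \<longlonglongrightarrow> x + 0 *\<^sub>R w"
    by (intro tendsto_intros LIMSEQ_inverse_real_of_nat)
  then have "(\<lambda>n. x + inverse (real (Suc n)) *\<^sub>R w) \<longlonglongrightarrow> x" by simp
  ultimately show "x \<in> closure f"
    unfolding closure_sequential by (intro exI conjI allI)
qed

lemma polyhedron_linear_ge:
  assumes "linear (\<alpha> :: 'a::euclidean_space \<Rightarrow> real)"
  shows "polyhedron {x. \<alpha> x \<ge> 0}"
proof -
  have "\<alpha> x = adjoint \<alpha> 1 \<bullet> x" for x
    using adjoint_works[OF assms, of x 1] by (simp add: inner_commute)
  then show ?thesis using polyhedron_halfspace_ge[where a = "adjoint \<alpha> 1" and b = 0] by simp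
qed

lemma polyhedron_closure_polyhedral_cone:
  assumes "polyhedral_cone V f" "subspace V" "f \<noteq> {}"
  shows "polyhedron (closure f)"
proof -
  obtain P Q where PQ: "finite P" "finite Q" "\<forall>\<alpha>\<in>P \<union> Q. linear (\<alpha> :: _ \<Rightarrow> real)"
    "f = {x \<in> V. (\<forall>\<alpha>\<in>P. \<alpha> x = 0) \<and> (\<forall>\<alpha>\<in>Q. \<alpha> x > 0)}"
    using assms(1) unfolding polyhedral_cone_def by blast
  have "subspace {x \<in> V. \<forall>\<alpha>\<in>P. \<alpha> x = 0}"
    using assms(2) PQ(3) by (auto simp: subspace_def linear_0 linear_add linear_scale)
  then have "polyhedron {x \<in> V. \<forall>\<alpha>\<in>P. \<alpha> x = 0}"
    by (intro affine_imp_polyhedron subspace_imp_affine)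
  moreover have "polyhedron (\<Inter>((\<lambda>\<alpha>. {x. \<alpha> x \<ge> 0}) ` Q))"
    using PQ(2,3) polyhedron_linear_ge by (intro polyhedron_Inter) auto
  moreover have "closure f = {x \<in> V. \<forall>\<alpha>\<in>P. \<alpha> x = 0} \<inter> \<Inter>((\<lambda>\<alpha>. {x. \<alpha> x \<ge> 0}) ` Q)"
    unfolding closure_polyhedral_cone_eq[OF PQ(3,4) assms(2,3)] by auto
  ultimately show ?thesis by simp
qed

lemma closure_polyhedral_cone_add_scale:
  assumes "polyhedral_cone V f" "subspace V" "f \<noteq> {}"
  shows "x \<in> closure f \<Longrightarrow> y \<in> closure f \<Longrightarrow> x + y \<in> closure f"
    and "x \<in> closure f \<Longrightarrow> (r::real) \<ge> 0 \<Longrightarrow> r *\<^sub>R x \<in> closure f"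
    and "x \<in> f \<Longrightarrow> y \<in> closure f \<Longrightarrow> x + y \<in> f"
    and "closure f \<subseteq> V"
proof -
  obtain P Q where PQ: "\<forall>\<alpha>\<in>P \<union> Q. linear (\<alpha> :: _ \<Rightarrow> real)"
    "f = {x \<in> V. (\<forall>\<alpha>\<in>P. \<alpha> x = 0) \<and> (\<forall>\<alpha>\<in>Q. \<alpha> x > 0)}"
    using assms(1) unfolding polyhedral_cone_def by blast
  note cl = closure_polyhedral_cone_eq[OF PQ assms(2,3)]
  show "x \<in> closure f \<Longrightarrow> y \<in> closure f \<Longrightarrow> x + y \<in> closure f"
    using PQ(1) assms(2) unfolding cl by (auto simp: linear_add subspace_add)
  show "x \<in> closure f \<Longrightarrow> (r::real) \<ge> 0 \<Longrightarrow> r *\<^sub>R x \<in> closure f"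
    using PQ(1) assms(2) unfolding cl by (auto simp: linear_scale subspace_scale)
  show "x \<in> f \<Longrightarrow> y \<in> closure f \<Longrightarrow> x + y \<in> f"
    using PQ(1) assms(2) unfolding cl by (subst PQ(2)) (auto simp: PQ(2) linear_add subspace_add add_pos_nonneg)
  show "closure f \<subseteq> V" unfolding cl by blast
qed

text \<open>
  Cut by a cube, the closed cone is a polytope, the convex hull of finitely many points. By scaling,
  these points generate the whole cone.
\<close>

lemma closure_polyhedral_cone_generated:
  assumes f: "polyhedral_cone V f" "subspace V" "f \<noteq> {}"
  shows "\<exists>S. finite S \<and> S \<subseteq> closure f \<and>
    (\<forall>x\<in>closure f. \<exists>c. (\<forall>v\<in>S. c v \<ge> 0) \<and> x = (\<Sum>v\<in>S. c v *\<^sub>R v))"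
proof -
  have "polytope (closure f \<inter> cbox (- One) One)"
    unfolding polytope_eq_bounded_polyhedron
  proof
    show "polyhedron (closure f \<inter> cbox (- One) One)"
      by (intro polyhedron_Int polyhedron_closure_polyhedral_cone[OF f] polytope_imp_polyhedron polytope_interval)
    show "bounded (closure f \<inter> cbox (- One) One)"
      by (intro bounded_Int disjI2 bounded_cbox)
  qed
  then obtain S where S: "finite S" "closure f \<inter> cbox (- One) One = convex hull S"
    unfolding polytope_def by blast
  have "\<exists>c. (\<forall>v\<in>S. c v \<ge> 0) \<and> x = (\<Sum>v\<in>S. c v *\<^sub>R v)" if x: "x \<in> closure f" for x
  proof -
    define r where "r = norm x + 1"
    have r: "r > 0" by (simp add: r_def add_nonneg_pos)
    have "- 1 \<le> inverse r * (x \<bullet> b) \<and> inverse r * (x \<bullet> b) \<le> 1" if "b \<in> Basis" for b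
    proof -
      have "- r \<le> x \<bullet> b" "x \<bullet> b \<le> r"
        using Basis_le_norm[OF that, of x] by (simp_all add: r_def abs_le_iff)
      then show ?thesis using r by (simp add: field_simps)
    qed
    then have "inverse r *\<^sub>R x \<in> cbox (- One) One"
      by (simp add: mem_box)
    moreover have "inverse r *\<^sub>R x \<in> closure f"
      using closure_polyhedral_cone_add_scale(2)[OF f x] r by simp
    ultimately have "inverse r *\<^sub>R x \<in> convex hull S" using S(2) by blast
    then obtain u where u: "\<forall>v\<in>S. u v \<ge> 0" "(\<Sum>v\<in>S. u v *\<^sub>R v) = inverse r *\<^sub>R x"
      unfolding convex_hull_finite[OF S(1)] by blast
    have "x = r *\<^sub>R (inverse r *\<^sub>R x)" using r by simp
    also have "\<dots> = (\<Sum>v\<in>S. (r * u v) *\<^sub>R v)"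
      by (simp only: u(2)[symmetric] scaleR_right.sum scaleR_scaleR)
    finally show ?thesis using u(1) r by (intro exI[of _ "\<lambda>v. r * u v"]) simp
  qed
  moreover have "S \<subseteq> closure f" using S(2) hull_subset[of S convex] by blast
  ultimately show ?thesis using S(1) by blast
qed

section \<open>Conical decompositions\<close>

locale conical_complex =
  fixes V :: "'a::euclidean_space set" and F :: "'a set set"
  assumes subspace: "subspace V" and decomposition: "conical_decomposition V F"
begin

lemma finite_F: "finite F" and Union_F: "\<Union>F = V"
  using decomposition unfolding conical_decomposition_def by auto

lemma cone_nonempty: "f \<noteq> {}" if "f \<in> F"
  using decomposition that unfolding conical_decomposition_def by auto

lemma cone_polyhedral: "polyhedral_cone V f" if "f \<in> F"
  using decomposition that unfolding conical_decomposition_def by auto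

lemma cone_subset: "f \<in> F \<Longrightarrow> f \<subseteq> V"
  using Union_F by blast

lemma cone_unique: "f \<in> F \<Longrightarrow> g \<in> F \<Longrightarrow> x \<in> f \<Longrightarrow> x \<in> g \<Longrightarrow> f = g"
  using decomposition unfolding conical_decomposition_def disjoint_def by blast

lemma cone_add: "f \<in> F \<Longrightarrow> x \<in> f \<Longrightarrow> y \<in> f \<Longrightarrow> x + y \<in> f"
  using polyhedral_cone_add[OF cone_polyhedral subspace] .

lemma cone_scale: "f \<in> F \<Longrightarrow> x \<in> f \<Longrightarrow> r > 0 \<Longrightarrow> r *\<^sub>R x \<in> f"
  using polyhedral_cone_scale[OF cone_polyhedral subspace] .

lemma closure_add: "f \<in> F \<Longrightarrow> x \<in> closure f \<Longrightarrow> y \<in> closure f \<Longrightarrow> x + y \<in> closure f"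
  and closure_scale: "f \<in> F \<Longrightarrow> x \<in> closure f \<Longrightarrow> r \<ge> 0 \<Longrightarrow> r *\<^sub>R x \<in> closure f"
  and add_closure: "f \<in> F \<Longrightarrow> x \<in> f \<Longrightarrow> y \<in> closure f \<Longrightarrow> x + y \<in> f"
  and closure_subset_space: "f \<in> F \<Longrightarrow> closure f \<subseteq> V"
  using closure_polyhedral_cone_add_scale[OF cone_polyhedral subspace cone_nonempty] by blast+

lemma zero_in_closure: "f \<in> F \<Longrightarrow> 0 \<in> closure f"
  using closure_scale[of f _ 0] cone_nonempty closure_subset by fastforce

lemma closure_sum_scale:
  assumes "f \<in> F" "\<And>v. v \<in> S \<Longrightarrow> v \<in> closure f" "\<And>v. v \<in> S \<Longrightarrow> c v \<ge> 0"
  shows "(\<Sum>v\<in>S. c v *\<^sub>R v) \<in> closure f"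
  using assms(2,3)
  by (induction S rule: infinite_finite_induct)
     (auto intro: zero_in_closure closure_add closure_scale assms(1))

lemma cone_diff_small:
  assumes "f \<in> F" "x \<in> f" "y \<in> closure f"
  obtains r where "r > 0" "x - r *\<^sub>R y \<in> f"
  using polyhedral_cone_small[OF cone_polyhedral subspace] assms by blast

text \<open>
  By the boundary condition the closure of \<open>g\<close> is a union of members, and members are disjoint.
\<close>

lemma subset_closure:
  assumes "f \<in> F" "g \<in> F" "x \<in> f" "x \<in> closure g"
  shows "f \<subseteq> closure g"
proof (cases "x \<in> g")
  case True
  then show ?thesis using cone_unique assms closure_subset by metis
next
  case False
  obtain G where G: "G \<subseteq> F - {g}" "cone_boundary g = \<Union>G"
    using decomposition assms(2) unfolding conical_decomposition_def by meson
  have "x \<in> \<Union>G" using False assms(4) G(2) unfolding cone_boundary_def by blast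
  then obtain f' where f': "f' \<in> G" "x \<in> f'" by blast
  then have "f' = f" using cone_unique assms G(1) by blast
  then show ?thesis using f' G(2) unfolding cone_boundary_def by blast
qed

lemma closure_face_eq:
  assumes "f \<in> F" "g \<in> F" "f \<subseteq> closure g"
  shows "closure f = span f \<inter> closure g"
proof (cases "f = g")
  case True
  have "closure g \<subseteq> span g" by (intro closure_minimal span_superset closed_subspace subspace_span)
  then show ?thesis using True by blast
next
  case False
  then have "f \<inter> g = {}" using cone_unique assms by blast
  then have "cone_face F f g"
    using assms False unfolding cone_face_def cone_boundary_def by blast
  then show ?thesis using decomposition unfolding conical_decomposition_def by blast
qed

text \<open>
  Since \<open>F\<close> is finite, closure commutes with cutting \<open>X\<close> into its pieces in the members of \<open>F\<close>. This
  takes the place of extracting, from a sequence in \<open>X\<close>, a subsequence in one member.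
\<close>

lemma closure_cone_Int:
  assumes "X \<subseteq> V" "x \<in> closure X"
  obtains f where "f \<in> F" "x \<in> closure (f \<inter> X)"
proof -
  have "closure X \<subseteq> (\<Union>f\<in>F. closure (f \<inter> X))"
  proof (rule closure_minimal)
    show "X \<subseteq> (\<Union>f\<in>F. closure (f \<inter> X))"
    proof
      fix z assume z: "z \<in> X"
      then obtain f where "f \<in> F" "z \<in> f" using assms(1) Union_F by blast
      then show "z \<in> (\<Union>f\<in>F. closure (f \<inter> X))"
        using z closure_subset[of "f \<inter> X"] by blast
    qed
    show "closed (\<Union>f\<in>F. closure (f \<inter> X))" using finite_F by (intro closed_UN) auto
  qed
  then show thesis using assms(2) that by blast
qed

text \<open>
  This finds the member in which the open ray from \<open>x\<close> in the direction \<open>d\<close> begins: as members are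
  convex and open in their span, \<open>f\<close> contains the whole open segment from \<open>x\<close> to \<open>x + r d\<close>.
\<close>

lemma cone_ahead:
  assumes "x \<in> V" "d \<in> V"
  obtains f r where "f \<in> F" "r > 0" "x \<in> closure f" "x + r *\<^sub>R d \<in> f"
proof -
  let ?X = "(\<lambda>r. x + r *\<^sub>R d) ` {0<..}"
  have "(\<lambda>n. x + inverse (real (Suc n)) *\<^sub>R d) \<longlonglongrightarrow> x + 0 *\<^sub>R d"
    by (intro tendsto_intros LIMSEQ_inverse_real_of_nat)
  then have "(\<lambda>n. x + inverse (real (Suc n)) *\<^sub>R d) \<longlonglongrightarrow> x" by simp
  moreover have "x + inverse (real (Suc n)) *\<^sub>R d \<in> ?X" for n by (rule imageI) simp
  ultimately have "x \<in> closure ?X"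
    unfolding closure_sequential by (intro exI conjI allI)
  moreover have "?X \<subseteq> V" using assms subspace by (auto intro: subspace_add subspace_scale)
  ultimately obtain f where f: "f \<in> F" "x \<in> closure (f \<inter> ?X)" using closure_cone_Int by metis
  then have "f \<inter> ?X \<noteq> {}" by auto
  moreover have "x \<in> closure f" using f(2) closure_mono[of "f \<inter> ?X" f] by blast
  ultimately show thesis using that f(1) by blast
qed

text \<open>
  The closure of \<open>k\<close> is an extreme subset (a face in the sense of convex geometry) of the closure of
  \<open>f\<close>. Let \<open>D\<close> be the relatively open convex face of \<open>closure f\<close> through \<open>x + y\<close>. A member that meets
  \<open>D\<close> lies in the closure of \<open>D\<close>. Among these members choose \<open>g\<close> of maximal dimension. It spans
  \<open>D\<close>: otherwise, a small step from a point of \<open>g\<close> along \<open>D\<close> would enter a member of larger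
  dimension. Hence \<open>D\<close> is contained in \<open>span g \<inter> closure f = closure g\<close>, and \<open>x + y\<close>, from which one
  can move backwards along \<open>g\<close> inside \<open>D\<close>, lies in \<open>g\<close> itself. Thus \<open>g = k\<close>, and \<open>x\<close> is in the span
  of \<open>D\<close>, hence in \<open>closure k\<close>.
\<close>

lemma summand_in_closure:
  assumes f: "f \<in> F" and k: "k \<in> F" and x: "x \<in> closure f" and y: "y \<in> closure f"
    and xy: "x + y \<in> k"
  shows "x \<in> closure k"
proof -
  define m where "m = x + y"
  obtain P Q where PQ: "finite P" "finite Q" "\<forall>\<alpha>\<in>P \<union> Q. linear (\<alpha> :: _ \<Rightarrow> real)"
    "f = {x \<in> V. (\<forall>\<alpha>\<in>P. \<alpha> x = 0) \<and> (\<forall>\<alpha>\<in>Q. \<alpha> x > 0)}"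
    using cone_polyhedral[OF f] unfolding polyhedral_cone_def by blast
  note clf = closure_polyhedral_cone_eq[OF PQ(3,4) subspace cone_nonempty[OF f]]
  \<comment> \<open>The forms of \<open>Q0\<close> are those that are tight at \<open>m\<close>; turning them into equations gives the face \<open>D\<close>.\<close>
  define Q0 where "Q0 = {\<alpha> \<in> Q. \<alpha> m = 0}"
  define D where "D = {z \<in> V. (\<forall>\<alpha>\<in>P \<union> Q0. \<alpha> z = 0) \<and> (\<forall>\<alpha>\<in>Q - Q0. \<alpha> z > 0)}"
  have Qpart: "(P \<union> Q0) \<union> (Q - Q0) = P \<union> Q" unfolding Q0_def by blast
  have lin: "\<forall>\<alpha>\<in>(P \<union> Q0) \<union> (Q - Q0). linear \<alpha>" unfolding Qpart by (rule PQ(3))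
  have fin: "finite (P \<union> Q0)" "finite (Q - Q0)" using PQ(1,2) unfolding Q0_def by auto
  have D: "polyhedral_cone V D"
    unfolding polyhedral_cone_def D_def
    by (rule exI[of _ "P \<union> Q0"], rule exI[of _ "Q - Q0"]) (intro conjI fin lin refl)
  have m: "m \<in> closure f" unfolding m_def using closure_add[OF f x y] .
  have mD: "m \<in> D"
    using m unfolding D_def clf Q0_def by (auto simp: order.order_iff_strict)
  then have Dne: "D \<noteq> {}" by blast
  note clD = closure_polyhedral_cone_eq[OF lin D_def subspace Dne]
  have Df: "D \<subseteq> closure f"
  proof
    fix z assume z: "z \<in> D"
    have "\<alpha> z \<ge> 0" if "\<alpha> \<in> Q" for \<alpha>
    proof -
      have "\<alpha> z = 0 \<or> \<alpha> z > 0" using z that unfolding D_def by blast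
      then show ?thesis by linarith
    qed
    then show "z \<in> closure f" using z unfolding D_def clf by auto
  qed
  \<comment> \<open>A tight form is nonnegative on \<open>g\<close> and zero at \<open>z\<close>. As \<open>g\<close> is open in its span, it also contains
    \<open>z - r w\<close> for some \<open>r > 0\<close>; so the form cannot be positive at \<open>w\<close>.\<close>
  have inD: "g \<subseteq> closure D" if g: "g \<in> F" "z \<in> g" "z \<in> D" for g z
  proof
    fix w assume w: "w \<in> g"
    have gf: "g \<subseteq> closure f" using subset_closure[OF g(1) f g(2)] Df g(3) by blast
    obtain r where r: "r > 0" "z - r *\<^sub>R w \<in> g"
      using cone_diff_small[OF g(1,2)] w closure_subset by blast
    have "\<alpha> w = 0" if \<alpha>: "\<alpha> \<in> Q0" for \<alpha>
    proof -
      have \<alpha>Q: "\<alpha> \<in> Q" using \<alpha> unfolding Q0_def by blast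
      have "\<alpha> (z - r *\<^sub>R w) \<ge> 0" "\<alpha> w \<ge> 0" using r(2) w gf \<alpha>Q unfolding clf by blast+
      moreover have "\<alpha> z = 0" using g(3) \<alpha> unfolding D_def by blast
      moreover have "\<alpha> (z - r *\<^sub>R w) = \<alpha> z - r * \<alpha> w"
        using PQ(3) \<alpha>Q by (auto simp: linear_diff linear_scale)
      moreover have "r * \<alpha> w \<ge> 0" using calculation(2) r(1) by simp
      ultimately have "r * \<alpha> w = 0" by linarith
      then show ?thesis using r(1) by simp
    qed
    then show "w \<in> closure D" using w gf unfolding clf clD by blast
  qed
  let ?G = "{g \<in> F. g \<inter> D \<noteq> {}}"
  have fin: "finite (dim ` ?G)" using finite_F by simp
  have "k \<in> ?G" using k xy mD unfolding m_def by blast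
  then have "Max (dim ` ?G) \<in> dim ` ?G" using fin by (intro Max_in) blast+
  then obtain g where g: "g \<in> ?G" "Max (dim ` ?G) = dim g" by blast
  have max: "dim g' \<le> dim g" if "g' \<in> F" "z \<in> g'" "z \<in> D" for g' z
    unfolding g(2)[symmetric] using that by (intro Max_ge fin) blast
  obtain z where z: "z \<in> g" "z \<in> D" using g(1) by blast
  have gF: "g \<in> F" using g(1) by blast
  have gf: "g \<subseteq> closure f" using subset_closure[OF gF f z(1)] Df z(2) by blast
  have Dspan: "D \<subseteq> span g"
  proof
    fix d assume d: "d \<in> D"
    have "z \<in> V" "d \<in> V" using z(2) d unfolding D_def by blast+
    then obtain g' r where g': "g' \<in> F" "r > 0" "z \<in> closure g'" "z + r *\<^sub>R d \<in> g'"
      by (rule cone_ahead)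
    have zd: "z + r *\<^sub>R d \<in> D"
      using polyhedral_cone_add[OF D subspace z(2)] polyhedral_cone_scale[OF D subspace d g'(2)] by blast
    have dg: "dim g' \<le> dim g" using max[OF g'(1,4) zd] .
    have "closure g' \<subseteq> span g'" by (intro closure_minimal span_superset closed_subspace subspace_span)
    then have "g \<subseteq> span g'" using subset_closure[OF gF g'(1) z(1) g'(3)] by blast
    then have "span g \<subseteq> span g'" by (rule span_minimal) (rule subspace_span)
    then have "span g = span g'"
      using dg by (intro subspace_dim_equal) (auto simp: dim_span)
    then have "(z + r *\<^sub>R d) - z \<in> span g"
      using z(1) g'(4) by (intro span_diff) (auto intro: span_base)
    then have "inverse r *\<^sub>R ((z + r *\<^sub>R d) - z) \<in> span g" by (rule span_scale)
    moreover have "inverse r *\<^sub>R ((z + r *\<^sub>R d) - z) = d" using g'(2) by simp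
    ultimately show "d \<in> span g" by (simp only:)
  qed
  note clg = closure_face_eq[OF gF f gf]
  have Dg: "D \<subseteq> closure g" unfolding clg using Dspan Df by blast
  have "m \<in> g"
  proof -
    obtain r where r: "r > 0" "m - r *\<^sub>R z \<in> D"
      using polyhedral_cone_small[OF D subspace mD] inD[OF gF z] z(1) by blast
    have "r *\<^sub>R z + (m - r *\<^sub>R z) \<in> g"
      using add_closure[OF gF cone_scale[OF gF z(1) r(1)]] r(2) Dg by blast
    then show ?thesis by simp
  qed
  then have kg: "k = g" using cone_unique k gF xy unfolding m_def by blast
  \<comment> \<open>The tight forms vanish at \<open>x\<close>, being nonnegative at \<open>x\<close> and at \<open>y\<close> with sum zero.\<close>
  have "m + x \<in> D"
  proof -
    have "x \<in> closure D"
    proof -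
      have "\<alpha> x = 0" if "\<alpha> \<in> Q0" for \<alpha>
      proof -
        have "\<alpha> \<in> Q" "\<alpha> m = 0" using that unfolding Q0_def by auto
        moreover from this have "\<alpha> x \<ge> 0" "\<alpha> y \<ge> 0" using x y unfolding clf by blast+
        moreover have "\<alpha> m = \<alpha> x + \<alpha> y"
          unfolding m_def using PQ(3) \<open>\<alpha> \<in> Q\<close> by (auto simp: linear_add)
        ultimately show ?thesis by linarith
      qed
      then show ?thesis using x unfolding clf clD by blast
    qed
    then show ?thesis using closure_polyhedral_cone_add_scale(3)[OF D subspace Dne mD] by blast
  qed
  then have "(m + x) - m \<in> span g" using Dspan mD by (intro span_diff) auto
  then show ?thesis using x unfolding kg clg by simp
qed

end


context conical_complex
begin

lemma span_cone_diff:
  assumes f: "f \<in> F" and x: "x \<in> span f"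
  obtains a b where "a \<in> f" "b \<in> f" "x = a - b"
proof -
  let ?D = "{a - b |a b. a \<in> f \<and> b \<in> f}"
  have "f \<subseteq> ?D"
  proof
    fix a assume "a \<in> f"
    then have "a + a \<in> f" using cone_add[OF f] by blast
    then show "a \<in> ?D" using \<open>a \<in> f\<close> by (intro CollectI exI[of _ "a + a"] exI[of _ a]) simp
  qed
  moreover have "subspace ?D"
    unfolding subspace_def
  proof (intro conjI ballI allI)
    show "0 \<in> ?D" using cone_nonempty[OF f] by force
    fix u assume "u \<in> ?D"
    then obtain a b where ab: "a \<in> f" "b \<in> f" "u = a - b" by blast
    show "u + v \<in> ?D" if v: "v \<in> ?D" for v
    proof -
      obtain a' b' where ab': "a' \<in> f" "b' \<in> f" "v = a' - b'" using v by blast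
      show ?thesis
        using cone_add[OF f ab(1) ab'(1)] cone_add[OF f ab(2) ab'(2)] ab(3) ab'(3)
        by (intro CollectI exI[of _ "a + a'"] exI[of _ "b + b'"]) simp
    qed
    show "r *\<^sub>R u \<in> ?D" for r :: real
    proof -
      consider "r > 0" | "r = 0" | "r < 0" by linarith
      then show ?thesis
      proof cases
        case 1
        then show ?thesis
          using cone_scale[OF f ab(1)] cone_scale[OF f ab(2)] ab(3)
          by (intro CollectI exI[of _ "r *\<^sub>R a"] exI[of _ "r *\<^sub>R b"]) (simp add: scaleR_diff_right)
      next
        case 2
        then show ?thesis using ab(1) by (intro CollectI exI[of _ a]) simp
      next
        case 3
        then show ?thesis
          using cone_scale[OF f ab(1), of "- r"] cone_scale[OF f ab(2), of "- r"] ab(3)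
          by (intro CollectI exI[of _ "(- r) *\<^sub>R b"] exI[of _ "(- r) *\<^sub>R a"]) (simp add: scaleR_diff_right)
      qed
    qed
  qed
  ultimately have "span f \<subseteq> ?D" by (rule span_minimal)
  then show thesis using x that by blast
qed

lemma convex_cone: "convex f" if "f \<in> F"
proof (rule convexI)
  fix x y and u v :: real
  assume *: "x \<in> f" "y \<in> f" "0 \<le> u" "0 \<le> v" "u + v = 1"
  consider "u = 0" "v = 1" | "v = 0" "u = 1" | "u > 0" "v > 0" using *(3-5) by fastforce
  then show "u *\<^sub>R x + v *\<^sub>R y \<in> f"
    using * by cases (auto intro: cone_add cone_scale that)
qed

text \<open>
  The convex set of differences \<open>x - y\<close> does not contain \<open>0\<close>. A supporting normal \<open>a\<close> that is chosen
  in the span of this set cannot vanish on all of it, which makes the separation proper. Scaling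
  \<open>x\<close> shows that the two cones lie on opposite sides of the hyperplane through \<open>0\<close>.
\<close>

lemma separate_cones:
  assumes f: "f \<in> F" and g: "g \<in> F" and ne: "f \<noteq> g"
  shows "\<exists>a. (\<forall>x\<in>f. a \<bullet> x \<ge> 0) \<and> (\<forall>y\<in>g. a \<bullet> y \<le> 0) \<and> (\<exists>u\<in>f. \<exists>v\<in>g. a \<bullet> v < a \<bullet> u)"
proof -
  let ?D = "{x - y |x y. x \<in> f \<and> y \<in> g}"
  have "?D = (\<Union>x\<in>f. \<Union>y\<in>g. {x - y})" by blast
  then have "convex ?D" using convex_differences[OF convex_cone[OF f] convex_cone[OF g]] by simp
  moreover have "?D \<noteq> {}" using cone_nonempty[OF f] cone_nonempty[OF g] by blast
  moreover have "0 \<notin> ?D" using cone_unique[OF f g] ne by auto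
  ultimately obtain a where a: "a \<in> span ?D" "a \<noteq> 0" "\<And>z. z \<in> ?D \<Longrightarrow> 0 \<le> a \<bullet> z"
    by (rule separating_hyperplane_set_0_inspan) blast
  have le: "a \<bullet> y \<le> r * (a \<bullet> x)" if "x \<in> f" "y \<in> g" "r > 0" for x y r
  proof -
    have "r *\<^sub>R x - y \<in> ?D" using cone_scale[OF f that(1,3)] that(2) by blast
    then have "0 \<le> a \<bullet> (r *\<^sub>R x - y)" by (rule a(3))
    then show ?thesis by (simp add: inner_diff_right)
  qed
  obtain x0 y0 where xy0: "x0 \<in> f" "y0 \<in> g" using cone_nonempty[OF f] cone_nonempty[OF g] by blast
  have fpos: "a \<bullet> x \<ge> 0" if x: "x \<in> f" for x
  proof (rule ccontr)
    assume "\<not> a \<bullet> x \<ge> 0"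
    then have neg: "a \<bullet> x < 0" by simp
    define r where "r = (1 + \<bar>a \<bullet> y0\<bar>) / - (a \<bullet> x)"
    have "r > 0" unfolding r_def using neg by (intro divide_pos_pos) linarith+
    moreover have "r * (a \<bullet> x) = - (1 + \<bar>a \<bullet> y0\<bar>)" unfolding r_def using neg by (simp add: field_simps)
    ultimately show False using le[OF x xy0(2), of r] by simp
  qed
  have gneg: "a \<bullet> y \<le> 0" if y: "y \<in> g" for y
  proof (rule ccontr)
    assume "\<not> a \<bullet> y \<le> 0"
    then have pos: "a \<bullet> y > 0" by simp
    define r where "r = (a \<bullet> y) / (1 + a \<bullet> x0)"
    have x0: "a \<bullet> x0 \<ge> 0" using fpos[OF xy0(1)] .
    have "r > 0" unfolding r_def using pos x0 by (intro divide_pos_pos) linarith+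
    moreover have "r * (a \<bullet> x0) < a \<bullet> y" unfolding r_def using pos x0 by (simp add: field_simps add_pos_nonneg)
    ultimately show False using le[OF xy0(1) y, of r] by simp
  qed
  have "\<exists>u\<in>f. \<exists>v\<in>g. a \<bullet> v < a \<bullet> u"
  proof (rule ccontr)
    assume no: "\<not> ?thesis"
    have zero: "a \<bullet> z = 0" if "z \<in> ?D" for z
    proof -
      obtain x y where xy: "x \<in> f" "y \<in> g" "z = x - y" using \<open>z \<in> ?D\<close> by blast
      have "\<not> a \<bullet> y < a \<bullet> x" using no xy(1,2) by blast
      then have "a \<bullet> x = a \<bullet> y" using fpos[OF xy(1)] gneg[OF xy(2)] by linarith
      then show ?thesis using xy(3) by (simp add: inner_diff_right)
    qed
    have "orthogonal a a"
      by (rule orthogonal_to_span[OF a(1)]) (unfold orthogonal_def, rule zero)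
    then show False using a(2) by (simp add: orthogonal_def)
  qed
  then show ?thesis using fpos gneg by (intro exI[of _ a] conjI ballI)
qed

definition carrier_cone :: "'a \<Rightarrow> 'a set"
  where "carrier_cone x = (THE f. f \<in> F \<and> x \<in> f)"

lemma carrier_cone_eq: "carrier_cone x = f" if "f \<in> F" "x \<in> f"
  unfolding carrier_cone_def using that cone_unique by (intro the_equality) blast+

lemma carrier_cone: "carrier_cone x \<in> F" "x \<in> carrier_cone x" if "x \<in> V"
proof -
  obtain f where "f \<in> F" "x \<in> f" using \<open>x \<in> V\<close> Union_F by blast
  then show "carrier_cone x \<in> F" "x \<in> carrier_cone x" using carrier_cone_eq by metis+
qed

end

section \<open>Classes of affine cones and their neighbourhoods\<close>

lemma nbhd_base_of_pointD:
  assumes "nbhd_base_of_point X x B"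
  shows "N \<in> B \<Longrightarrow> \<exists>S. openin X S \<and> x \<in> S \<and> S \<subseteq> N"
    and "openin X S \<Longrightarrow> x \<in> S \<Longrightarrow> \<exists>N\<in>B. N \<subseteq> S"
proof -
  assume "N \<in> B"
  then show "\<exists>S. openin X S \<and> x \<in> S \<and> S \<subseteq> N"
    using assms[unfolded nbhd_base_of_point_def, THEN conjunct1] by simp
next
  assume "openin X S" "x \<in> S"
  then show "\<exists>N\<in>B. N \<subseteq> S"
    using assms[unfolded nbhd_base_of_point_def, THEN conjunct2] by simp
qed

locale apartment_compactification =
  fixes A :: "'a::euclidean_space set" and W :: "('a \<Rightarrow> 'a) set" and F :: "'a set set"
  assumes apartment: "apartment A W" and decomp: "conical_decomposition (direction A) F"
begin

abbreviation "V \<equiv> direction A"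
abbreviation "T \<equiv> compactified_apartment A W F"
abbreviation "nbhd g e \<equiv> basic_nbhd A F g (ball 0 e \<inter> V)"

lemma affine_A: "affine A" and A_nonempty: "A \<noteq> {}"
  using apartment unfolding apartment_def by auto

sublocale conical_complex V F
  by unfold_locales (rule affine_direction[OF affine_A A_nonempty], rule decomp)

lemma translate_in_A: "s \<in> A \<Longrightarrow> v \<in> V \<Longrightarrow> s + v \<in> A"
  using affine_add_direction[OF affine_A] .

definition cone_class :: "'a \<Rightarrow> 'a set \<Rightarrow> 'a set set"
  where "cone_class s f = cone_equiv A F `` {(+) s ` f}"

lemma mem_cone_class_iff:
  assumes "s \<in> A" "f \<in> F"
  shows "h \<in> cone_class s f \<longleftrightarrow> (\<exists>t\<in>A. h = (+) t ` f \<and> (\<exists>a\<in>f. \<exists>b\<in>f. s + a = t + b))"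
proof
  assume "h \<in> cone_class s f"
  then obtain s' t f' where *: "(+) s ` f = (+) s' ` f'" "h = (+) t ` f'" "t \<in> A" "f' \<in> F"
    "(+) s' ` f' \<inter> (+) t ` f' \<noteq> {}"
    unfolding cone_class_def cone_equiv_def by blast
  have "f = f'" using translate_cone_eq[OF decomp subspace assms(2) *(4,1)] .
  moreover have "(+) s ` f \<inter> (+) t ` f \<noteq> {}" using * calculation by simp
  then have "\<exists>a\<in>f. \<exists>b\<in>f. s + a = t + b" by blast
  ultimately show "\<exists>t\<in>A. h = (+) t ` f \<and> (\<exists>a\<in>f. \<exists>b\<in>f. s + a = t + b)" using *(2,3) by blast
next
  assume "\<exists>t\<in>A. h = (+) t ` f \<and> (\<exists>a\<in>f. \<exists>b\<in>f. s + a = t + b)"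
  then obtain t a b where *: "t \<in> A" "h = (+) t ` f" "a \<in> f" "b \<in> f" "s + a = t + b" by blast
  have "(+) s ` f \<inter> (+) t ` f \<noteq> {}" using *(3-5) by blast
  then show "h \<in> cone_class s f"
    using assms *(1,2) unfolding cone_class_def cone_equiv_def by blast
qed

lemma cone_class_mem:
  assumes "s \<in> A" "f \<in> F"
  shows "(+) s ` f \<in> cone_class s f"
proof -
  obtain a where a: "a \<in> f" using cone_nonempty[OF assms(2)] by blast
  show ?thesis
    unfolding mem_cone_class_iff[OF assms]
    by (intro bexI[of _ s] conjI refl bexI[of _ a] assms(1) a)
qed

lemma cone_class_in: "s \<in> A \<Longrightarrow> f \<in> F \<Longrightarrow> cone_class s f \<in> cone_classes A F"
  unfolding cone_class_def cone_classes_def by (intro quotientI) (auto simp: affine_cones_def)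

lemma cone_class_eqI:
  assumes "s \<in> A" "t \<in> A" "f \<in> F" "a \<in> f" "b \<in> f" "s + a = t + b"
  shows "cone_class s f = cone_class t f"
proof -
  have "((+) s ` f, (+) t ` f) \<in> cone_equiv A F"
    using mem_cone_class_iff[OF assms(1,3)] assms unfolding cone_class_def by blast
  then show ?thesis
    unfolding cone_class_def by (rule equiv_class_eq[OF equiv_cone_equiv[OF affine_A A_nonempty decomp]])
qed

lemma shifted_cone_mem:
  assumes "s \<in> A" "f \<in> F" "u \<in> f"
  shows "(+) (s + u) ` f \<in> cone_class s f"
proof -
  have "s + u \<in> A" using translate_in_A[OF assms(1)] cone_subset[OF assms(2)] assms(3) by blast
  moreover have "s + (u + u) = (s + u) + u" by (simp add: add.assoc)
  ultimately show ?thesis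
    unfolding mem_cone_class_iff[OF assms(1,2)]
    by (intro bexI[of _ "s + u"] conjI refl bexI[of _ u] bexI[of _ "u + u"] cone_add[OF assms(2,3,3)] assms(3))
qed

lemma cone_classesE:
  assumes "x \<in> cone_classes A F"
  obtains s f where "s \<in> A" "f \<in> F" "x = cone_class s f"
proof -
  obtain g where g: "g \<in> affine_cones A F" "x = cone_equiv A F `` {g}"
    using assms unfolding cone_classes_def by (rule quotientE)
  then obtain s f where "s \<in> A" "f \<in> F" "g = (+) s ` f" unfolding affine_cones_def by blast
  then show thesis using that g(2) unfolding cone_class_def by simp
qed

lemma cone_topology: "is_cone_topology A W F T"
  using is_cone_topology_compactified_apartment[OF apartment decomp] .

lemma topspace_T: "topspace T = cone_classes A F"
  using cone_topology unfolding is_cone_topology_def by (rule conjunct1)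

lemma nbhd_base:
  assumes "x \<in> cone_classes A F"
  shows "nbhd_base_of_point T x {basic_nbhd A F g U |g U. g \<in> x \<and> U \<in> stable_nbhds A W}"
  using cone_topology[unfolded is_cone_topology_def, THEN conjunct2] assms by (rule bspec)

text \<open>
  Since \<open>W\<close> acts on directions by isometries, balls are stable neighbourhoods, and the topology can be
  tested with the neighbourhoods \<open>nbhd g e\<close> alone.
\<close>

lemma nbhd_contains_open:
  assumes "x \<in> cone_classes A F" "g \<in> x" "e > 0"
  obtains S where "openin T S" "x \<in> S" "S \<subseteq> nbhd g e"
proof -
  have "nbhd g e \<in> {basic_nbhd A F g U |g U. g \<in> x \<and> U \<in> stable_nbhds A W}"
    using assms(2) ball_stable_nbhd[OF apartment assms(3)] by blast
  from nbhd_base_of_pointD(1)[OF nbhd_base[OF assms(1)] this]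
  show thesis using that by blast
qed

lemma open_contains_nbhd:
  assumes "openin T S" "x \<in> S"
  obtains g e where "g \<in> x" "e > 0" "nbhd g e \<subseteq> S"
proof -
  have "x \<in> cone_classes A F" using openin_subset[OF assms(1)] assms(2) topspace_T by blast
  from nbhd_base_of_pointD(2)[OF nbhd_base[OF this] assms]
  obtain g U where gU: "g \<in> x" "U \<in> stable_nbhds A W" "basic_nbhd A F g U \<subseteq> S" by blast
  obtain e where e: "e > 0" "ball 0 e \<inter> V \<subseteq> U" using stable_nbhd_ball[OF gU(2)] by blast
  have "nbhd g e \<subseteq> basic_nbhd A F g U"
    using set_plus_mono2[OF order_refl e(2)] unfolding basic_nbhd_def by blast
  then show thesis using that[OF gU(1) e(1)] gU(3) by blast
qed

section \<open>Separation\<close>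

text \<open>
  This is the geometric content of the Hausdorff property: disjoint representatives would not
  suffice, since they can be asymptotic to each other, so the lemma provides a gap.
\<close>

lemma separate_classes:
  assumes x: "x \<in> cone_classes A F" and y: "y \<in> cone_classes A F" and "x \<noteq> y"
  shows "\<exists>p\<in>x. \<exists>q\<in>y. \<exists>a c d. d < c \<and> (\<forall>z\<in>p. a \<bullet> z \<ge> c) \<and> (\<forall>z\<in>q. a \<bullet> z \<le> d)"
proof -
  obtain s f where s: "s \<in> A" "f \<in> F" "x = cone_class s f" using x by (rule cone_classesE)
  obtain t g where t: "t \<in> A" "g \<in> F" "y = cone_class t g" using y by (rule cone_classesE)
  \<comment> \<open>For equal directions, \<open>a\<close> is the component of \<open>s - t\<close> orthogonal to the direction; for different
    directions, moving the apices \<open>r\<close> times along \<open>u\<close> and \<open>v\<close> outweighs the initial positions.\<close>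
  show ?thesis
  proof (cases "f = g")
    case True
    obtain u a where ua: "u \<in> span f" "\<And>w. w \<in> span f \<Longrightarrow> orthogonal a w" "s - t = u + a"
      by (rule orthogonal_subspace_decomp_exists[of f "s - t"]) blast
    have "a \<noteq> 0"
    proof
      assume "a = 0"
      then have "s - t \<in> span f" using ua(1,3) by simp
      then obtain b b' where "b \<in> f" "b' \<in> f" "s - t = b - b'" by (rule span_cone_diff[OF s(2)])
      then have "cone_class s f = cone_class t f"
        by (intro cone_class_eqI[OF s(1) t(1) s(2), of b' b]) (auto simp: algebra_simps)
      then show False using assms(3) s(3) t(3) True by simp
    qed
    moreover have "a \<bullet> (s - t) = a \<bullet> a"
      using ua(2)[OF ua(1)] unfolding ua(3) by (simp add: orthogonal_def inner_add_right)
    ultimately have "a \<bullet> (s - t) > 0" by simp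
    then have lt: "a \<bullet> t < a \<bullet> s" by (simp add: inner_diff_right)
    have zero: "a \<bullet> w = 0" if "w \<in> f" for w
      using ua(2)[OF span_base[OF that]] by (simp add: orthogonal_def)
    show ?thesis
    proof (intro bexI exI[of _ a] exI conjI ballI, rule lt)
      show "(+) s ` f \<in> x" unfolding s(3) by (intro cone_class_mem s)
      show "(+) t ` g \<in> y" unfolding t(3) by (intro cone_class_mem t)
    qed (use zero True in \<open>auto simp: inner_add_right\<close>)
  next
    case False
    from separate_cones[OF s(2) t(2) False]
    obtain a u v where a: "\<forall>x\<in>f. a \<bullet> x \<ge> 0" "\<forall>y\<in>g. a \<bullet> y \<le> 0"
      "u \<in> f" "v \<in> g" "a \<bullet> v < a \<bullet> u"
      by (elim exE bexE conjE)
    define r where "r = (\<bar>a \<bullet> t - a \<bullet> s\<bar> + 1) / (a \<bullet> u - a \<bullet> v)"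
    have r: "r > 0" unfolding r_def using a(5) by (intro divide_pos_pos) linarith+
    have "r * (a \<bullet> u - a \<bullet> v) = \<bar>a \<bullet> t - a \<bullet> s\<bar> + 1" unfolding r_def using a(5) by simp
    then have "r * (a \<bullet> u) - r * (a \<bullet> v) = \<bar>a \<bullet> t - a \<bullet> s\<bar> + 1" by (simp only: right_diff_distrib)
    then have lt: "a \<bullet> (t + r *\<^sub>R v) < a \<bullet> (s + r *\<^sub>R u)"
      unfolding inner_add_right inner_scaleR_right by linarith
    have ge: "\<forall>z\<in>(+) s' ` f. a \<bullet> s' \<le> a \<bullet> z" for s'
      using a(1) by (simp add: inner_add_right)
    have le: "\<forall>z\<in>(+) t' ` g. a \<bullet> z \<le> a \<bullet> t'" for t'
      using a(2) by (simp add: inner_add_right)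
    show ?thesis
    proof (intro bexI exI conjI, rule lt)
      show "(+) (s + r *\<^sub>R u) ` f \<in> x"
        unfolding s(3) by (intro shifted_cone_mem s cone_scale a(3) r)
      show "(+) (t + r *\<^sub>R v) ` g \<in> y"
        unfolding t(3) by (intro shifted_cone_mem t cone_scale a(4) r)
    qed (rule ge le)+
  qed
qed

lemma inner_nbhd:
  assumes "h \<subseteq> p + (ball 0 e \<inter> V)" "\<forall>z\<in>p. a \<bullet> z \<ge> c" "w \<in> h"
  shows "a \<bullet> w \<ge> c - norm a * e"
proof -
  obtain z v where zv: "z \<in> p" "norm v < e" "w = z + v"
    using assms(1,3) by (auto simp: set_plus_def)
  have "\<bar>a \<bullet> v\<bar> \<le> norm a * norm v" by (rule Cauchy_Schwarz_ineq2)
  also have "\<dots> \<le> norm a * e" using zv(2) by (intro mult_left_mono) auto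
  finally show ?thesis using bspec[OF assms(2) zv(1)] zv(3) by (simp add: inner_add_right)
qed

lemma Hausdorff_space_T: "Hausdorff_space T"
  unfolding Hausdorff_space_def topspace_T
proof (intro allI impI, elim conjE)
  fix x y assume xy: "x \<in> cone_classes A F" "y \<in> cone_classes A F" "x \<noteq> y"
  obtain p q a c d where sep: "p \<in> x" "q \<in> y" "d < c"
    "\<forall>z\<in>p. a \<bullet> z \<ge> c" "\<forall>z\<in>q. a \<bullet> z \<le> d"
    by (rule separate_classes[OF xy, THEN bexE]) (elim bexE exE conjE)
  define e where "e = (c - d) / (2 * (norm a + 1))"
  have e: "e > 0" unfolding e_def using sep(3) by (simp add: add_nonneg_pos)
  have "norm a * e < (norm a + 1) * e" using e by simp
  also have "\<dots> = (c - d) / 2"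
    unfolding e_def using norm_ge_zero[of a] by (simp add: field_simps add_nonneg_eq_0_iff)
  finally have small: "norm a * e < (c - d) / 2" .
  obtain U where U: "openin T U" "x \<in> U" "U \<subseteq> nbhd p e" by (rule nbhd_contains_open[OF xy(1) sep(1) e])
  obtain U' where U': "openin T U'" "y \<in> U'" "U' \<subseteq> nbhd q e" by (rule nbhd_contains_open[OF xy(2) sep(2) e])
  have False if zpq: "z \<in> nbhd p e" "z \<in> nbhd q e" for z
  proof -
    obtain h h' where h: "z \<in> cone_classes A F" "h \<in> z" "h \<subseteq> p + (ball 0 e \<inter> V)"
      "h' \<in> z" "h' \<subseteq> q + (ball 0 e \<inter> V)"
      using zpq unfolding basic_nbhd_def by blast
    obtain k where k: "k \<in> z" "k \<subseteq> h" "k \<subseteq> h'"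
      using cone_class_directed[OF affine_A A_nonempty decomp h(1,2,4)] by blast
    obtain s f where s: "s \<in> A" "f \<in> F" "z = cone_class s f" using h(1) by (rule cone_classesE)
    then have "k \<noteq> {}" using k(1) mem_cone_class_iff[OF s(1,2)] by auto
    then obtain w where w: "w \<in> h" "w \<in> h'" using k(2,3) by blast
    have "a \<bullet> w \<ge> c - norm a * e" using inner_nbhd[OF h(3) sep(4) w(1)] .
    moreover have "(- a) \<bullet> w \<ge> (- d) - norm (- a) * e"
      using sep(5) by (intro inner_nbhd[OF h(5) _ w(2)]) simp
    ultimately show False using small by simp
  qed
  then have "disjnt U U'" using U(3) U'(3) unfolding disjnt_def by blast
  then show "\<exists>U U'. openin T U \<and> openin T U' \<and> x \<in> U \<and> y \<in> U' \<and> disjnt U U'"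
    using U U' by blast
qed

end


section \<open>Classes with coefficients in the extended half-line\<close>

text \<open>
  The same two parameters serve for all coefficients, so that a product of such boxes describes how
  infinite coefficients become large while finite ones change little.
\<close>

definition ennreal_box :: "real \<Rightarrow> real \<Rightarrow> ennreal \<Rightarrow> ennreal set"
  where "ennreal_box N \<delta> a =
    (if a = \<infinity> then {ennreal N<..} else {z. z \<noteq> \<infinity> \<and> \<bar>enn2real z - enn2real a\<bar> < \<delta>})"

lemma mem_ennreal_box: "\<delta> > 0 \<Longrightarrow> a \<in> ennreal_box N \<delta> a"
  unfolding ennreal_box_def by simp

lemma open_ennreal_box: "open (ennreal_box N \<delta> a)"
proof (cases "a = \<infinity>")
  case True
  then show ?thesis unfolding ennreal_box_def by simp
next
  case False
  define r where "r = enn2real a"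
  have "ennreal_box N \<delta> a = {..<ennreal (r + \<delta>)} \<inter> (if r - \<delta> < 0 then UNIV else {ennreal (r - \<delta>)<..})"
  proof (rule Set.set_eqI)
    fix z
    show "z \<in> ennreal_box N \<delta> a \<longleftrightarrow> z \<in> {..<ennreal (r + \<delta>)} \<inter> (if r - \<delta> < 0 then UNIV else {ennreal (r - \<delta>)<..})"
    proof (cases z)
      case (real x)
      then show ?thesis
        using False unfolding ennreal_box_def r_def[symmetric] by (auto simp: ennreal_less_iff)
    next
      case top
      then show ?thesis using False unfolding ennreal_box_def by simp
    qed
  qed
  then show ?thesis by (simp add: open_Int)
qed

context conical_complex
begin

lemma sum_in_closure_summand:
  assumes f: "f \<in> F" and h: "h \<in> F" and S: "finite S" "S \<subseteq> closure f"
    and c: "\<forall>v\<in>S. c v \<ge> 0" and sum: "(\<Sum>v\<in>S. c v *\<^sub>R v) \<in> h"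
    and v: "v \<in> S" "c v > 0"
  shows "v \<in> closure h"
proof -
  have 1: "c v *\<^sub>R v \<in> closure f" using closure_scale[OF f, of v "c v"] S(2) v by auto
  have 2: "(\<Sum>u\<in>S - {v}. c u *\<^sub>R u) \<in> closure f"
    using S(2) c by (intro closure_sum_scale[OF f]) auto
  have "c v *\<^sub>R v + (\<Sum>u\<in>S - {v}. c u *\<^sub>R u) \<in> h"
    using sum sum.remove[OF S(1) v(1), of "\<lambda>u. c u *\<^sub>R u"] by simp
  then have "c v *\<^sub>R v \<in> closure h" by (rule summand_in_closure[OF f h 1 2])
  then have "inverse (c v) *\<^sub>R (c v *\<^sub>R v) \<in> closure h"
    by (rule closure_scale[OF h]) (use v(2) in simp)
  moreover have "inverse (c v) *\<^sub>R (c v *\<^sub>R v) = v" using v(2) by simp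
  ultimately show ?thesis by (simp only:)
qed

text \<open>
  The member of \<open>F\<close> that contains a nonnegative combination depends only on its support. The new sum is obtained from
  a small multiple of the given sum by adding nonnegative multiples of generators that lie in the
  closure of \<open>h\<close>.
\<close>

lemma sum_support_in_cone:
  assumes f: "f \<in> F" and h: "h \<in> F" and S: "finite S" "S \<subseteq> closure f"
    and c: "\<forall>v\<in>S. c v \<ge> 0" and sum: "(\<Sum>v\<in>S. c v *\<^sub>R v) \<in> h"
  shows "(\<Sum>v | v \<in> S \<and> c v > 0. v) \<in> h"
proof -
  let ?I = "{v \<in> S. c v > 0}"
  define r where "r = inverse (1 + (\<Sum>v\<in>S. c v))"
  have sum0: "(\<Sum>v\<in>S. c v) \<ge> 0" using c by (intro sum_nonneg) blast
  have r: "r > 0" unfolding r_def using sum0 by simp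
  have le: "r * c v \<le> 1" if "v \<in> S" for v
  proof -
    have "c v \<le> (\<Sum>v\<in>S. c v)" using S(1) c that by (intro member_le_sum) auto
    then show ?thesis unfolding r_def using sum0 by (simp add: field_simps)
  qed
  have "(\<Sum>v\<in>S. c v *\<^sub>R v) = (\<Sum>v\<in>?I. c v *\<^sub>R v)"
    using S(1) c by (intro sum.mono_neutral_right) (auto simp: order.order_iff_strict)
  then have eq: "r *\<^sub>R (\<Sum>v\<in>S. c v *\<^sub>R v) + (\<Sum>v\<in>?I. (1 - r * c v) *\<^sub>R v) = (\<Sum>v\<in>?I. v)"
    by (simp add: scaleR_right.sum sum.distrib[symmetric] scaleR_left_diff_distrib)
  have "(\<Sum>v\<in>?I. (1 - r * c v) *\<^sub>R v) \<in> closure h"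
  proof (rule closure_sum_scale[OF h])
    fix v assume v: "v \<in> ?I"
    then show "v \<in> closure h" using sum_in_closure_summand[OF f h S c sum] by simp
    show "1 - r * c v \<ge> 0" using le v by simp
  qed
  from add_closure[OF h cone_scale[OF h sum r] this] show ?thesis unfolding eq .
qed

end

context apartment_compactification
begin

text \<open>
  The limit, for \<open>n \<rightarrow> \<infinity>\<close>, of the points of \<open>A\<close> with coefficients \<open>min n (c v)\<close>. As \<open>enn2real \<infinity> = 0\<close>,
  only the finite coefficients contribute to the apex.
\<close>

definition limit_class :: "'a \<Rightarrow> 'a set \<Rightarrow> ('a \<Rightarrow> ennreal) \<Rightarrow> 'a set set"
  where "limit_class p S c =
    cone_class (p + (\<Sum>v\<in>S. enn2real (c v) *\<^sub>R v)) (carrier_cone (\<Sum>v | v \<in> S \<and> c v = \<infinity>. v))"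

lemma generators_subset: "f \<in> F \<Longrightarrow> S \<subseteq> closure f \<Longrightarrow> v \<in> S \<Longrightarrow> v \<in> V"
  using closure_subset_space by blast

lemma limit_class_base:
  assumes p: "p \<in> A" and f: "f \<in> F" and S: "S \<subseteq> closure f"
  shows "p + (\<Sum>v\<in>S. enn2real (c v) *\<^sub>R v) \<in> A"
    and "carrier_cone (\<Sum>v | v \<in> S \<and> c v = \<infinity>. v) \<in> F"
    and "(\<Sum>v | v \<in> S \<and> c v = \<infinity>. v) \<in> carrier_cone (\<Sum>v | v \<in> S \<and> c v = \<infinity>. v)"
proof -
  have V: "v \<in> V" if "v \<in> S" for v using generators_subset[OF f S that] .
  show "p + (\<Sum>v\<in>S. enn2real (c v) *\<^sub>R v) \<in> A"
    using V by (intro translate_in_A p subspace_sum subspace_scale subspace) auto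
  have "(\<Sum>v | v \<in> S \<and> c v = \<infinity>. v) \<in> V"
    using V by (intro subspace_sum subspace) auto
  then show "carrier_cone (\<Sum>v | v \<in> S \<and> c v = \<infinity>. v) \<in> F"
    "(\<Sum>v | v \<in> S \<and> c v = \<infinity>. v) \<in> carrier_cone (\<Sum>v | v \<in> S \<and> c v = \<infinity>. v)"
    by (rule carrier_cone)+
qed

lemma limit_class_in:
  assumes "p \<in> A" "f \<in> F" "S \<subseteq> closure f"
  shows "limit_class p S c \<in> cone_classes A F"
  unfolding limit_class_def using limit_class_base[OF assms] by (intro cone_class_in)

text \<open>
  Continuity of \<open>limit_class p S\<close> at \<open>c\<close>. Let \<open>k\<close> be the direction at \<open>c\<close>. For \<open>c'\<close> near \<open>c\<close> fewer
  coefficients are infinite, so the direction at \<open>c'\<close> is contained in \<open>closure k\<close>. The other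
  coefficients that are infinite at \<open>c\<close> are at least \<open>N\<close> at \<open>c'\<close>, which pushes the cone at \<open>c'\<close> into \<open>g\<close>.
  The remaining coefficients change by less than \<open>\<delta>\<close> and move the cone by less than \<open>e\<close>.
\<close>

lemma limit_class_near:
  assumes p: "p \<in> A" and f: "f \<in> F" and S: "finite S" "S \<subseteq> closure f"
    and g: "g \<in> limit_class p S c" and e: "e > 0"
  shows "\<exists>N \<delta>. \<delta> > 0 \<and>
    (\<forall>c'\<in>PiE S (\<lambda>v. ennreal_box N \<delta> (c v)). limit_class p S c' \<in> nbhd g e)"
proof -
  let ?I = "{v \<in> S. c v = \<infinity>}"
  define m where "m = \<Sum>?I"
  define k where "k = carrier_cone m"
  define s where "s = (\<Sum>v\<in>S. enn2real (c v) *\<^sub>R v)"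
  have base: "p + s \<in> A" and k: "k \<in> F" and mk: "m \<in> k"
    using limit_class_base[OF p f S(2), of c] unfolding m_def k_def s_def by simp_all
  have "g \<in> cone_class (p + s) k"
    using g unfolding limit_class_def m_def k_def s_def by simp
  then obtain t a b where g: "g = (+) t ` k" "t \<in> A" and ab: "a \<in> k" "b \<in> k" "(p + s) + a = t + b"
    unfolding mem_cone_class_iff[OF base k] by (elim bexE conjE)
  have Ik: "v \<in> closure k" if "v \<in> ?I" for v
  proof (rule sum_in_closure_summand[OF f k])
    show "finite ?I" "?I \<subseteq> closure f" using S by auto
    show "(\<Sum>v\<in>?I. 1 *\<^sub>R v) \<in> k" using mk unfolding m_def by simp
  qed (use that in simp_all)
  \<comment> \<open>\<open>N\<close> is so large that \<open>N m\<close> compensates for the difference \<open>a\<close> between the apex of \<open>g\<close> and \<open>p + s\<close>.\<close>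
  obtain r where r: "r > 0" "m - r *\<^sub>R a \<in> k"
    using cone_diff_small[OF k mk] closure_subset ab(1) by (metis subsetD)
  define N where "N = inverse r"
  have N: "N > 0" unfolding N_def using r(1) by simp
  have deep: "N *\<^sub>R m - a \<in> k"
    using cone_scale[OF k r(2) N] r(1) unfolding N_def by (simp add: scaleR_diff_right)
  define \<delta> where "\<delta> = e / (1 + (\<Sum>v\<in>S. norm v))"
  have norm_pos: "1 + (\<Sum>v\<in>S. norm v) > 0" by (intro add_pos_nonneg sum_nonneg) simp_all
  have \<delta>: "\<delta> > 0" unfolding \<delta>_def using e norm_pos by simp
  show ?thesis
  proof (rule exI[of _ N], rule exI[of _ \<delta>], intro conjI ballI \<delta>)
    fix c' assume c': "c' \<in> PiE S (\<lambda>v. ennreal_box N \<delta> (c v))"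
    let ?I' = "{v \<in> S. c' v = \<infinity>}"
    define m' where "m' = \<Sum>?I'"
    define k' where "k' = carrier_cone m'"
    define s' where "s' = (\<Sum>v\<in>S. enn2real (c' v) *\<^sub>R v)"
    have base': "p + s' \<in> A" and k': "k' \<in> F" and mk': "m' \<in> k'"
      using limit_class_base[OF p f S(2), of c'] unfolding m'_def k'_def s'_def by simp_all
    have class': "limit_class p S c' = cone_class (p + s') k'"
      unfolding limit_class_def m'_def k'_def s'_def by simp
    have far: "ennreal N < c' v" if "v \<in> S" "c v = \<infinity>" for v
      using PiE_mem[OF c' that(1)] that(2) unfolding ennreal_box_def by simp
    have close: "c' v \<noteq> \<infinity>" "\<bar>enn2real (c' v) - enn2real (c v)\<bar> < \<delta>"
      if "v \<in> S" "c v \<noteq> \<infinity>" for v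
      using PiE_mem[OF c' that(1)] that(2) unfolding ennreal_box_def by simp_all
    have I'I: "?I' \<subseteq> ?I" using close(1) by blast
    have "(\<Sum>v\<in>?I'. 1 *\<^sub>R v) \<in> closure k"
      using Ik I'I by (intro closure_sum_scale[OF k]) auto
    then have "m' \<in> closure k" unfolding m'_def by simp
    then have k'k: "k' \<subseteq> closure k" by (rule subset_closure[OF k' k mk'])
    \<comment> \<open>The representative at \<open>c'\<close> is moved by \<open>N m'\<close> along its own direction, so that all coefficients
      that are infinite at \<open>c\<close> become at least \<open>N\<close>, including those that are infinite at \<open>c'\<close>.\<close>
    define C where "C v = enn2real (c' v) + (if c' v = \<infinity> then N else 0)" for v
    define u where "u = (\<Sum>v\<in>S - ?I. (enn2real (c' v) - enn2real (c v)) *\<^sub>R v)"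
    have CI: "C v \<ge> N" if v: "v \<in> ?I" for v
    proof (cases "c' v = \<infinity>")
      case True
      then show ?thesis unfolding C_def by simp
    next
      case False
      have "ennreal N \<le> c' v" using far v by (simp add: less_imp_le)
      then have "enn2real (ennreal N) \<le> enn2real (c' v)"
        using False by (intro enn2real_mono) (simp_all add: less_top)
      then have "N \<le> enn2real (c' v)" using N by simp
      then show ?thesis using False unfolding C_def by simp
    qed
    have "u \<in> V"
      unfolding u_def using generators_subset[OF f S(2)]
      by (intro subspace_sum subspace_scale subspace) auto
    moreover have "norm u < e"
    proof -
      have "norm u \<le> (\<Sum>v\<in>S - ?I. norm ((enn2real (c' v) - enn2real (c v)) *\<^sub>R v))"
        unfolding u_def by (rule norm_sum)
      also have "\<dots> \<le> (\<Sum>v\<in>S - ?I. \<delta> * norm v)"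
      proof (rule sum_mono)
        fix v assume "v \<in> S - ?I"
        then have "\<bar>enn2real (c' v) - enn2real (c v)\<bar> < \<delta>" using close(2) by blast
        then show "norm ((enn2real (c' v) - enn2real (c v)) *\<^sub>R v) \<le> \<delta> * norm v"
          by (simp add: mult_right_mono)
      qed
      also have "\<dots> \<le> (\<Sum>v\<in>S. \<delta> * norm v)"
        using S(1) \<delta> by (intro sum_mono2) auto
      also have "\<dots> = \<delta> * (\<Sum>v\<in>S. norm v)" by (simp add: sum_distrib_left)
      also have "\<dots> < \<delta> * (1 + (\<Sum>v\<in>S. norm v))" using \<delta> by (intro mult_strict_left_mono) simp_all
      also have "\<dots> = e" unfolding \<delta>_def using norm_pos by simp
      finally show ?thesis .
    qed
    ultimately have uball: "u \<in> ball 0 e \<inter> V" by simp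
    have m'sum: "N *\<^sub>R m' = (\<Sum>v\<in>S. (if c' v = \<infinity> then N else 0) *\<^sub>R v)"
      unfolding m'_def scaleR_right.sum using S(1)
      by (intro sum.mono_neutral_cong_left) auto
    have "s' + N *\<^sub>R m' - s = (\<Sum>v\<in>S. (C v - enn2real (c v)) *\<^sub>R v)"
      unfolding s'_def s_def m'sum C_def
      by (simp add: sum.distrib sum_subtractf scaleR_left_distrib scaleR_left_diff_distrib)
    also have "\<dots> = (\<Sum>v\<in>S - ?I. (C v - enn2real (c v)) *\<^sub>R v) + (\<Sum>v\<in>?I. (C v - enn2real (c v)) *\<^sub>R v)"
      using S(1) by (intro sum.subset_diff) auto
    also have "(\<Sum>v\<in>S - ?I. (C v - enn2real (c v)) *\<^sub>R v) = u"
      unfolding u_def by (rule sum.cong) (use close(1) in \<open>auto simp: C_def\<close>)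
    also have "(\<Sum>v\<in>?I. (C v - enn2real (c v)) *\<^sub>R v) = (\<Sum>v\<in>?I. (C v - N) *\<^sub>R v) + N *\<^sub>R m"
      unfolding m_def scaleR_right.sum sum.distrib[symmetric] scaleR_left_distrib[symmetric]
      by (rule sum.cong) simp_all
    finally have shift: "s' + N *\<^sub>R m' = s + u + (\<Sum>v\<in>?I. (C v - N) *\<^sub>R v) + N *\<^sub>R m"
      by (simp add: algebra_simps)
    have rest: "(\<Sum>v\<in>?I. (C v - N) *\<^sub>R v) \<in> closure k"
      using Ik CI by (intro closure_sum_scale[OF k]) auto
    define h where "h = (+) (p + s' + N *\<^sub>R m') ` k'"
    have "h \<in> limit_class p S c'"
      unfolding class' h_def by (intro shifted_cone_mem base' k' cone_scale mk' N)
    moreover have "h \<subseteq> g + (ball 0 e \<inter> V)"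
    proof
      fix w assume "w \<in> h"
      then obtain z where z: "z \<in> k'" "w = p + s' + N *\<^sub>R m' + z" unfolding h_def by blast
      define y where "y = (N *\<^sub>R m - a) + (b + (\<Sum>v\<in>?I. (C v - N) *\<^sub>R v) + z)"
      have "y \<in> k"
        unfolding y_def using k'k z(1)
        by (intro cone_add[OF k deep] add_closure[OF k] ab(2) rest) auto
      then have "t + y \<in> g" unfolding g(1) by (rule imageI)
      moreover have "w = (t + y) + u"
      proof -
        have "t = p + s + a - b" using ab(3) by (simp add: algebra_simps)
        then show ?thesis
          unfolding z(2) y_def using shift by (simp add: algebra_simps)
      qed
      ultimately show "w \<in> g + (ball 0 e \<inter> V)" using set_plus_intro[OF _ uball] by metis
    qed
    ultimately show "limit_class p S c' \<in> nbhd g e"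
      unfolding basic_nbhd_def using limit_class_in[OF p f S(2), of c'] by blast
  qed
qed

lemma continuous_map_limit_class:
  assumes p: "p \<in> A" and f: "f \<in> F" and S: "finite S" "S \<subseteq> closure f"
  shows "continuous_map (product_topology (\<lambda>_. euclidean) S) T (limit_class p S)"
  unfolding continuous_map_def topspace_T
proof (intro conjI allI impI)
  let ?X = "product_topology (\<lambda>_. euclidean :: ennreal topology) S"
  show "limit_class p S \<in> topspace ?X \<rightarrow> cone_classes A F" 
    using limit_class_in[OF p f S(2)] by simp
  fix U assume U: "openin T U"
  show "openin ?X {c \<in> topspace ?X. limit_class p S c \<in> U}"
  proof (subst openin_subopen, intro ballI)
    fix c assume "c \<in> {c \<in> topspace ?X. limit_class p S c \<in> U}"
    then have c: "c \<in> PiE S (\<lambda>_. UNIV)" "limit_class p S c \<in> U" by auto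
    obtain g e where ge: "g \<in> limit_class p S c" "e > 0" "nbhd g e \<subseteq> U"
      by (rule open_contains_nbhd[OF U c(2)])
    obtain N \<delta> where \<delta>: "\<delta> > 0" and
      near: "\<forall>c'\<in>PiE S (\<lambda>v. ennreal_box N \<delta> (c v)). limit_class p S c' \<in> nbhd g e"
      using limit_class_near[OF p f S ge(1,2)] by (elim exE conjE)
    let ?B = "PiE S (\<lambda>v. ennreal_box N \<delta> (c v))"
    have "openin ?X ?B" using S(1) by (simp add: openin_PiE open_ennreal_box)
    moreover have "c \<in> ?B" using c(1) mem_ennreal_box[OF \<delta>] by (auto simp: PiE_iff)
    moreover have "?B \<subseteq> {c \<in> topspace ?X. limit_class p S c \<in> U}"
    proof
      fix c' assume c': "c' \<in> ?B"
      then have "limit_class p S c' \<in> U" using near ge(3) by blast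
      then show "c' \<in> {c \<in> topspace ?X. limit_class p S c \<in> U}"
        using c' by (simp add: PiE_iff)
    qed
    ultimately show "\<exists>Y. openin ?X Y \<and> c \<in> Y \<and> Y \<subseteq> {c \<in> topspace ?X. limit_class p S c \<in> U}"
      by (intro exI conjI)
  qed
qed

section \<open>Compactness\<close>

text \<open>
  Let \<open>x\<close> be the class of \<open>t + h\<close> and \<open>w \<in> h\<close>. Far out, the ray \<open>t + n w\<close>, seen from \<open>p\<close>, reaches a
  member \<open>f\<close> of \<open>F\<close> whose closure contains \<open>w\<close>. Coefficients of \<open>w\<close> in terms of generators of that
  closure tell which coefficients of \<open>x\<close> are infinite; the others are read off from a point of the ray.
\<close>

lemma limit_class_surj:
  assumes p: "p \<in> A" and x: "x \<in> cone_classes A F"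
  shows "\<exists>f\<in>F. \<forall>S. finite S \<and> S \<subseteq> closure f \<and>
      (\<forall>y\<in>closure f. \<exists>c. (\<forall>v\<in>S. c v \<ge> 0) \<and> y = (\<Sum>v\<in>S. c v *\<^sub>R v)) \<longrightarrow>
      x \<in> limit_class p S ` PiE S (\<lambda>_. UNIV)"
proof -
  obtain t h where t: "t \<in> A" "h \<in> F" "x = cone_class t h" using x by (rule cone_classesE)
  obtain w where w: "w \<in> h" using cone_nonempty[OF t(2)] by blast
  have wV: "w \<in> V" using cone_subset[OF t(2)] w by blast
  have "t - p \<in> V" unfolding direction_def using t(1) p by blast
  then obtain f r where f: "f \<in> F" "r > 0" "w \<in> closure f" "w + r *\<^sub>R (t - p) \<in> f"
    by (rule cone_ahead[OF wV])
  have "inverse r *\<^sub>R (w + r *\<^sub>R (t - p)) \<in> f" using f(2) by (intro cone_scale[OF f(1,4)]) simp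
  then have "t - p + inverse r *\<^sub>R w \<in> f"
    using f(2) by (simp add: scaleR_right_distrib add.commute)
  then have tf: "t - p + inverse r *\<^sub>R w \<in> closure f" using closure_subset by blast
  show ?thesis
  proof (intro bexI[OF _ f(1)] allI impI, elim conjE)
    fix S assume S: "finite S" "S \<subseteq> closure f"
      and gen: "\<forall>y\<in>closure f. \<exists>c. (\<forall>v\<in>S. c v \<ge> 0) \<and> y = (\<Sum>v\<in>S. c v *\<^sub>R v)"
    obtain c where c: "\<forall>v\<in>S. c v \<ge> (0::real)" "w = (\<Sum>v\<in>S. c v *\<^sub>R v)" using bspec[OF gen f(3)] by blast
    obtain d where d: "\<forall>v\<in>S. d v \<ge> (0::real)" "t - p + inverse r *\<^sub>R w = (\<Sum>v\<in>S. d v *\<^sub>R v)"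
      using bspec[OF gen tf] by blast
    let ?I = "{v \<in> S. c v > 0}"
    define C where "C = (\<lambda>v\<in>S. if c v > 0 then \<infinity> else ennreal (d v))"
    have "{v \<in> S. C v = \<infinity>} = ?I" unfolding C_def by auto
    moreover have wh: "(\<Sum>v\<in>S. c v *\<^sub>R v) \<in> h" using w c(2) by simp
    ultimately have carrier: "carrier_cone (\<Sum>v | v \<in> S \<and> C v = \<infinity>. v) = h"
      using carrier_cone_eq[OF t(2) sum_support_in_cone[OF f(1) t(2) S c(1) wh]] by simp
    let ?s = "\<Sum>v\<in>S. enn2real (C v) *\<^sub>R v"
    have s: "?s = (\<Sum>v\<in>S - ?I. d v *\<^sub>R v)"
      using S(1) d(1) by (intro sum.mono_neutral_cong_right) (auto simp: C_def)
    have "(\<Sum>v\<in>S. d v *\<^sub>R v) = (\<Sum>v\<in>S - ?I. d v *\<^sub>R v) + (\<Sum>v\<in>?I. d v *\<^sub>R v)"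
      using S(1) by (intro sum.subset_diff) auto
    then have ts: "p + ?s + (w + (\<Sum>v\<in>?I. d v *\<^sub>R v)) = t + (w + inverse r *\<^sub>R w)"
      using d(2) unfolding s by (simp add: algebra_simps)
    have "(\<Sum>v\<in>?I. d v *\<^sub>R v) \<in> closure h"
      using sum_in_closure_summand[OF f(1) t(2) S c(1) wh] d(1)
      by (intro closure_sum_scale[OF t(2)]) auto
    then have 1: "w + (\<Sum>v\<in>?I. d v *\<^sub>R v) \<in> h" by (rule add_closure[OF t(2) w])
    have 2: "w + inverse r *\<^sub>R w \<in> h"
      using f(2) by (intro cone_add[OF t(2) w] cone_scale[OF t(2) w]) simp
    have "limit_class p S C = x"
      unfolding limit_class_def carrier t(3)
      using limit_class_base(1)[OF p f(1) S(2), of C] by (rule cone_class_eqI[OF _ t(1,2) 1 2 ts])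
    moreover have "C \<in> PiE S (\<lambda>_. UNIV)" unfolding C_def by auto
    ultimately show "x \<in> limit_class p S ` PiE S (\<lambda>_. UNIV)" by blast
  qed
qed

lemma compact_space_T: "compact_space T"
proof -
  let ?X = "\<lambda>S. product_topology (\<lambda>_. euclidean :: ennreal topology) S"
  obtain p where p: "p \<in> A" using A_nonempty by blast
  have "\<forall>f\<in>F. \<exists>S. finite S \<and> S \<subseteq> closure f \<and>
    (\<forall>y\<in>closure f. \<exists>c. (\<forall>v\<in>S. c v \<ge> 0) \<and> y = (\<Sum>v\<in>S. c v *\<^sub>R v))"
    using closure_polyhedral_cone_generated[OF cone_polyhedral subspace cone_nonempty] by (intro ballI)
  then obtain G where G: "\<forall>f\<in>F. finite (G f) \<and> G f \<subseteq> closure f \<and>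
    (\<forall>y\<in>closure f. \<exists>c. (\<forall>v\<in>G f. c v \<ge> 0) \<and> y = (\<Sum>v\<in>G f. c v *\<^sub>R v))"
    by (rule bchoice[THEN exE])
  let ?K = "\<lambda>f. limit_class p (G f) ` topspace (?X (G f))"
  have "compactin T (?K f)" if f: "f \<in> F" for f
  proof (rule image_compactin)
    have "compact_space (euclidean :: ennreal topology)"
      unfolding compact_space_def by (simp add: compact_UNIV)
    then have "compact_space (?X (G f))" by (simp add: compact_space_product_topology)
    then show "compactin (?X (G f)) (topspace (?X (G f)))" unfolding compact_space_def .
    show "continuous_map (?X (G f)) T (limit_class p (G f))"
      using bspec[OF G f] by (intro continuous_map_limit_class[OF p f]) simp_all
  qed
  then have "compactin T (\<Union>f\<in>F. ?K f)" using finite_F by (intro compactin_Union) auto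
  moreover have "(\<Union>f\<in>F. ?K f) = topspace T"
  proof
    have "?K f \<subseteq> topspace T" if f: "f \<in> F" for f
      unfolding topspace_T using limit_class_in[OF p f] bspec[OF G f] by (intro image_subsetI) simp
    then show "(\<Union>f\<in>F. ?K f) \<subseteq> topspace T" by (rule UN_least)
    show "topspace T \<subseteq> (\<Union>f\<in>F. ?K f)"
    proof
      fix x assume "x \<in> topspace T"
      then have "x \<in> cone_classes A F" unfolding topspace_T .
      from limit_class_surj[OF p this]
      obtain f where f: "f \<in> F" and surj: "\<forall>S. finite S \<and> S \<subseteq> closure f \<and>
        (\<forall>y\<in>closure f. \<exists>c. (\<forall>v\<in>S. c v \<ge> 0) \<and> y = (\<Sum>v\<in>S. c v *\<^sub>R v)) \<longrightarrow>
        x \<in> limit_class p S ` PiE S (\<lambda>_. UNIV)"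
        by (elim bexE)
      have "x \<in> limit_class p (G f) ` PiE (G f) (\<lambda>_. UNIV)"
        using surj[THEN spec, of "G f"] bspec[OF G f] by (rule mp)
      then have "x \<in> ?K f" by simp
      then show "x \<in> (\<Union>f\<in>F. ?K f)" using f by blast
    qed
  qed
  ultimately show ?thesis unfolding compact_space_def by simp
qed

end

theorem proposition3p2p8:
  fixes A\<^sub>0 :: "'a::euclidean_space set"
    and W :: "('a \<Rightarrow> 'a) set"
    and F :: "'a set set"
  assumes "apartment A\<^sub>0 W"
    and "conical_decomposition (direction A\<^sub>0) F"
  shows "compact_space (compactified_apartment A\<^sub>0 W F) \<and>
         Hausdorff_space (compactified_apartment A\<^sub>0 W F)"
proof -
  interpret apartment_compactification "A\<^sub>0" W F
    using assms by unfold_locales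
  show ?thesis using compact_space_T Hausdorff_space_T by (rule conjI)
qed

end
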